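(* Let $n\ge1$, let $q\ge1$ be real and let $x_1,\dots,x_n$ be positive reals with $x_1+\cdots+x_n=1$. For a subset $S\subseteq[n]$ written $S=\{i_1>i_2>\cdots>i_k\}$ put $\lambda_S(q,{\sf x})=\sum_{j=1}^k \frac{x_{i_j}}{q^{n-i_j-j+1}}$. Then the characteristic polynomial of the $n!\times n!$ transition matrix of the $q$-Tsetlin library $\mathcal{T}_{\mathfrak{S}_n}(q,{\sf x})$ is $\prod_{S\subseteq[n]}(t-\lambda_S(q,{\sf x}))^{d_{n-|S|}}$; that is, the eigenvalues are the $\lambda_S(q,{\sf x})$, with $\lambda_S(q,{\sf x})$ occurring with multiplicity $d_{n-|S|}$. Moreover, $\mathcal{T}_{\mathfrak{S}_n}(q,{\sf x})$ is diagonalizable whenever ${\sf x}$ is generic in the sense that $\lambda_T(q,{\sf x})=\lambda_S(q,{\sf x})$ implies $S=T$.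
   Context: Permutations $\pi\in\mathfrak{S}_n$ are in one-line notation; $\pi s_i$ swaps the entries in positions $i,i+1$. On the real vector space with basis $\mathfrak{S}_n$, Hecke generators act on the right by $\pi\cdot T_i=q\,\pi s_i$ if $\pi_{i+1}<\pi_i$ and $\pi\cdot T_i=\pi s_i+(q-1)\pi$ if $\pi_{i+1}>\pi_i$. Let $\pi\cdot\mathcal{X}=\frac{x_{\pi_1}}{q^{n-\pi_1}}\pi$. The $q$-Tsetlin library is $\mathcal{T}_{\mathfrak{S}_n}(q,{\sf x})=\sum_{i=1}^nT_{i-1}\cdots T_1\mathcal{X}$ acting on the right (apply $T_{i-1}$ first, then $T_{i-2}$, …, then $T_1$, then $\mathcal{X}$; the $i=1$ term is $\mathcal{X}$); its transition matrix has entry (row $\pi$, column $\sigma$) equal to the coefficient of $\sigma$ in $\pi\cdot\mathcal{T}_{\mathfrak{S}_n}(q,{\sf x})$. The derangement number is $d_m=m!\sum_{k=0}^m\frac{(-1)^k}{k!}$, the number of fixed-point-free permutations of $[m]$. *)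

theory Defs
  imports
    Complex_Main
    "HOL-Combinatorics.Permutations"
    "Jordan_Normal_Form.Char_Poly"
begin

text \<open>
  A permutation of \<open>[n]\<close> is a function \<open>\<pi>\<close> with \<open>\<pi> permutes {1..n}\<close>; its one-line notation is
  \<open>\<pi> 1, \<dots>, \<pi> n\<close>, and \<open>\<pi> s\<^sub>i\<close> is \<open>\<pi> \<circ> transpose i (i + 1)\<close>.
  A vector of the real vector space with basis \<open>S\<^sub>n\<close> is given by its coefficient function; only the
  values at elements of \<open>S\<^sub>n\<close> matter.
\<close>

definition sym_perms :: "nat \<Rightarrow> (nat \<Rightarrow> nat) set" where
  "sym_perms n = {\<pi>. \<pi> permutes {1..n}}"

type_synonym perm_vec = "(nat \<Rightarrow> nat) \<Rightarrow> real"

definition basis_vec :: "(nat \<Rightarrow> nat) \<Rightarrow> perm_vec" where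
  "basis_vec \<pi> = (\<lambda>\<sigma>. if \<sigma> = \<pi> then 1 else 0)"

definition lin_ext :: "nat \<Rightarrow> ((nat \<Rightarrow> nat) \<Rightarrow> perm_vec) \<Rightarrow> perm_vec \<Rightarrow> perm_vec" where
  "lin_ext n f v = (\<lambda>\<sigma>. \<Sum>\<pi>\<in>sym_perms n. v \<pi> * f \<pi> \<sigma>)"

text \<open>All operators act on the right; they are written here as functions of the vector.\<close>

definition hecke_T :: "nat \<Rightarrow> real \<Rightarrow> nat \<Rightarrow> perm_vec \<Rightarrow> perm_vec" where
  "hecke_T n q i = lin_ext n (\<lambda>\<pi> \<sigma>.
     if \<pi> (i + 1) < \<pi> i
     then q * basis_vec (\<pi> \<circ> transpose i (i + 1)) \<sigma>
     else basis_vec (\<pi> \<circ> transpose i (i + 1)) \<sigma> + (q - 1) * basis_vec \<pi> \<sigma>)"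

definition weight_X :: "nat \<Rightarrow> real \<Rightarrow> (nat \<Rightarrow> real) \<Rightarrow> perm_vec \<Rightarrow> perm_vec" where
  "weight_X n q x = lin_ext n (\<lambda>\<pi> \<sigma>. x (\<pi> 1) / q ^ (n - \<pi> 1) * basis_vec \<pi> \<sigma>)"

text \<open>
  \<open>hecke_desc n q m v\<close> is \<open>v \<cdot> T\<^sub>m T\<^sub>m\<^sub>-\<^sub>1 \<cdots> T\<^sub>1\<close>, with \<open>T\<^sub>m\<close> applied first and \<open>T\<^sub>1\<close> last.
\<close>

fun hecke_desc :: "nat \<Rightarrow> real \<Rightarrow> nat \<Rightarrow> perm_vec \<Rightarrow> perm_vec" where
  "hecke_desc n q 0 v = v"
| "hecke_desc n q (Suc m) v = hecke_desc n q m (hecke_T n q (Suc m) v)"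

definition q_tsetlin :: "nat \<Rightarrow> real \<Rightarrow> (nat \<Rightarrow> real) \<Rightarrow> perm_vec \<Rightarrow> perm_vec" where
  "q_tsetlin n q x v = (\<lambda>\<sigma>. \<Sum>i=1..n. weight_X n q x (hecke_desc n q (i - 1) v) \<sigma>)"

text \<open>
  The rows and columns are ordered by an enumeration \<open>e\<close> of \<open>S\<^sub>n\<close>, i.e. a bijection from
  \<open>{0..<n!}\<close> onto \<open>S\<^sub>n\<close>.
\<close>

definition transition_matrix ::
  "nat \<Rightarrow> real \<Rightarrow> (nat \<Rightarrow> real) \<Rightarrow> (nat \<Rightarrow> nat \<Rightarrow> nat) \<Rightarrow> real mat" where
  "transition_matrix n q x e =
     mat (fact n) (fact n) (\<lambda>(a, b). q_tsetlin n q x (basis_vec (e a)) (e b))"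

text \<open>
  \<open>desc_elem S j\<close> is the \<open>j\<close>-th largest element \<open>i\<^sub>j\<close> of the finite set \<open>S\<close>, counting from \<open>j = 1\<close>.
\<close>

definition desc_elem :: "nat set \<Rightarrow> nat \<Rightarrow> nat" where
  "desc_elem S j = rev (sorted_list_of_set S) ! (j - 1)"

text \<open>
  The exponent is \<open>n - i\<^sub>j - j + 1\<close>. It is a natural number since \<open>i\<^sub>j \<le> n - j + 1\<close>, but \<open>n - i\<^sub>j - j\<close>
  can be \<open>-1\<close>, so with truncated subtraction the \<open>1\<close> has to be added first.
\<close>

definition tsetlin_eigenvalue :: "nat \<Rightarrow> real \<Rightarrow> (nat \<Rightarrow> real) \<Rightarrow> nat set \<Rightarrow> real" where
  "tsetlin_eigenvalue n q x S =
     (\<Sum>j=1..card S. x (desc_elem S j) / q ^ (n + 1 - desc_elem S j - j))"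

definition derangement_number :: "nat \<Rightarrow> nat" where
  "derangement_number m = card {\<pi>. \<pi> permutes {1..m} \<and> (\<forall>i\<in>{1..m}. \<pi> i \<noteq> i)}"

lemma derangement_number_formula:
  "real (derangement_number m) = fact m * (\<Sum>k\<le>m. (- 1) ^ k / fact k)"
proof -
  define f :: "nat set \<Rightarrow> real" where
    "f S = real (card {\<pi>. \<pi> permutes S \<and> (\<forall>i\<in>S. \<pi> i \<noteq> i)})" for S
  have decomp: "fact (card S) = sum f (Pow S)" if S: "finite S" for S
  proof -
    have fin: "finite {\<pi>. \<pi> permutes T \<and> (\<forall>i\<in>T. \<pi> i \<noteq> i)}" if "T \<subseteq> S" for T
      using finite_permutations[OF finite_subset[OF that S]] by simp
    have eq: "{\<pi>. \<pi> permutes S} = (\<Union>T\<in>Pow S. {\<pi>. \<pi> permutes T \<and> (\<forall>i\<in>T. \<pi> i \<noteq> i)})"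
    proof (intro equalityI subsetI)
      fix \<pi> assume "\<pi> \<in> {\<pi>. \<pi> permutes S}"
      then have p: "\<pi> permutes S" by simp
      have "\<pi> permutes {i\<in>S. \<pi> i \<noteq> i}"
        by (rule permutes_superset[OF p]) auto
      then show "\<pi> \<in> (\<Union>T\<in>Pow S. {\<pi>. \<pi> permutes T \<and> (\<forall>i\<in>T. \<pi> i \<noteq> i)})"
        by (intro UN_I[of "{i\<in>S. \<pi> i \<noteq> i}"]) simp_all
    next
      fix \<pi> assume "\<pi> \<in> (\<Union>T\<in>Pow S. {\<pi>. \<pi> permutes T \<and> (\<forall>i\<in>T. \<pi> i \<noteq> i)})"
      then obtain T where "T \<subseteq> S" "\<pi> permutes T" by auto
      then show "\<pi> \<in> {\<pi>. \<pi> permutes S}"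
        using permutes_subset by simp
    qed
    have supp: "T = {i. \<pi> i \<noteq> i}" if "\<pi> permutes T" "\<forall>i\<in>T. \<pi> i \<noteq> i" for \<pi> T
      using that permutes_not_in[OF that(1)] by fast
    have "card {\<pi>. \<pi> permutes S}
        = (\<Sum>T\<in>Pow S. card {\<pi>. \<pi> permutes T \<and> (\<forall>i\<in>T. \<pi> i \<noteq> i)})"
      unfolding eq
    proof (rule card_UN_disjoint)
      show "\<forall>T\<in>Pow S. \<forall>U\<in>Pow S. T \<noteq> U \<longrightarrow>
          {\<pi>. \<pi> permutes T \<and> (\<forall>i\<in>T. \<pi> i \<noteq> i)} \<inter> {\<pi>. \<pi> permutes U \<and> (\<forall>i\<in>U. \<pi> i \<noteq> i)} = {}"
        using supp by fast
    qed (use S fin in auto)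
    then have "real (fact (card S)) = sum f (Pow S)"
      unfolding card_permutations[OF refl S] by (simp only: f_def[abs_def] of_nat_sum)
    then show ?thesis by simp
  qed
  have "real (derangement_number m) = f {1..m}"
    by (simp add: f_def derangement_number_def)
  also have "\<dots> = (\<Sum>T\<in>Pow {1..m}. (- 1) ^ (card {1..m} - card T) * fact (card T))"
    by (rule inclusion_exclusion_mobius) (auto simp: decomp)
  also have "\<dots> = (\<Sum>k\<le>m. \<Sum>T | T \<in> Pow {1..m} \<and> card T = k. (- 1) ^ (m - card T) * fact (card T))"
  proof -
    have "card ` Pow {1..m} \<subseteq> {..m}"
      using card_mono[of "{1..m}"] by auto
    from sum.group[OF _ _ this, of "\<lambda>T. (- 1) ^ (m - card T) * fact (card T) :: real"]
    show ?thesis by simp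
  qed
  also have "\<dots> = (\<Sum>k\<le>m. real (m choose k) * ((- 1) ^ (m - k) * fact k))"
    using n_subsets[of "{1..m}"] by (intro sum.cong) auto
  also have "\<dots> = (\<Sum>k\<le>m. real (m choose (m - k)) * ((- 1) ^ k * fact (m - k)))"
    by (rule sum.reindex_bij_witness[of _ "\<lambda>k. m - k" "\<lambda>k. m - k"]) auto
  also have "\<dots> = (\<Sum>k\<le>m. fact m * ((- 1) ^ k / fact k))"
    by (intro sum.cong refl) (simp add: binomial_fact field_simps)
  finally show ?thesis
    by (simp add: sum_distrib_left)
qed

definition diagonalizable_mat :: "real mat \<Rightarrow> bool" where
  "diagonalizable_mat A \<longleftrightarrow> (\<exists>D. diagonal_mat D \<and> similar_mat A D)"

end

theory Submission
  imports Defs "HOL-Library.Function_Algebras" "HOL-Combinatorics.Multiset_Permutations"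
begin

text \<open>
  In terms of words, the coefficient of a word \<open>a w\<close> in \<open>v\<close> times the library operator is
  \<open>y\<^sub>a\<close> times the coefficient of \<open>w\<close> in \<open>\<partial>\<^sub>a v\<close>, where \<open>y\<^sub>a = x\<^sub>a / q\<^bsup>n-a\<^esup>\<close> and \<open>\<partial>\<^sub>a\<close> is a
  \<open>q\<close>-deletion of the letter \<open>a\<close>. The deletions \<open>q\<close>-commute. Let \<open>K\<^sub>B\<close> be the space of combinations
  of arrangements of \<open>B\<close> that all deletions kill, and let \<open>f\<^sub>S\<close> be the stationary vector of
  the operator on arrangements of \<open>S\<close>, which can be written down recursively. Juxtaposing \<open>f\<^sub>S\<close> with
  \<open>g \<in> K\<close> of the complement of \<open>S\<close> gives an eigenvector with eigenvalue \<open>\<lambda>\<^sub>S\<close>, because deletions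
  of the juxtaposition act on \<open>f\<^sub>S\<close> only. Deleting the letters of \<open>S\<close> recovers \<open>g\<close>, and a Taylor
  expansion argument shows that every vector is uniquely a sum over \<open>S\<close> of such juxtapositions.
  Hence \<open>n! = \<Sum>\<^sub>S dim K\<close>, which forces \<open>dim K\<^sub>B\<close> to be the derangement number of \<open>|B|\<close>.
\<close>

section \<open>Deletion of a letter\<close>

text \<open>
  \<open>del q a v w\<close> pairs \<open>v\<close> with \<open>(a w)(1 + T\<^sub>1 + T\<^sub>1 T\<^sub>2 + \<dots>)\<close>, the \<open>T\<^sub>i\<close> being transposed. It is
  meaningful for distinct letters only; the value at \<open>a = b\<close> is arbitrary.
\<close>

fun del :: "real \<Rightarrow> nat \<Rightarrow> (nat list \<Rightarrow> real) \<Rightarrow> nat list \<Rightarrow> real" where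
  "del q a v [] = v [a]"
| "del q a v (b # w) = v (a # b # w) +
     (if a < b then q * del q a (\<lambda>u. v (b # u)) w + (q - 1) * del q b (\<lambda>u. v (a # u)) w
      else del q a (\<lambda>u. v (b # u)) w)"

lemma del_zero [simp]: "del q a (\<lambda>u. 0) w = 0"
  by (induction w arbitrary: a) auto

lemma del_add: "del q a (\<lambda>u. f u + g u) w = del q a f w + del q a g w"
  by (induction w arbitrary: a f g) (auto simp: algebra_simps)

lemma del_cmult: "del q a (\<lambda>u. c * f u) w = c * del q a f w"
  by (induction w arbitrary: a f) (auto simp: algebra_simps)

lemma del_diff: "del q a (\<lambda>u. f u - g u) w = del q a f w - del q a g w"
  using del_add[of q a f "\<lambda>u. - 1 * g u" w] del_cmult[of q a "- 1" g w] by simp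

lemma del_sum: "del q a (\<lambda>u. \<Sum>i\<in>I. f i u) w = (\<Sum>i\<in>I. del q a (f i) w)"
  by (induction I rule: infinite_finite_induct) (auto simp: del_add)

text \<open>Every term of the recursion evaluates \<open>v\<close> at rearrangements of
  \<open>a # b # w\<close>; in the term with factor \<open>q - 1\<close>, \<open>a\<close> stays in
  front and \<open>b\<close> is deleted, which leaves the multiset unchanged.\<close>

lemma del_nonzero_mset:
  assumes "\<And>u. v u \<noteq> 0 \<Longrightarrow> mset u = N" and "del q a v w \<noteq> 0"
  shows "add_mset a (mset w) = N"
  using assms
proof (induction w arbitrary: a v N)
  case Nil
  then show ?case by force
next
  case (Cons b w)
  have shift: "mset u = N - {#c#} \<and> c \<in># N" if "v (c # u) \<noteq> 0" for c u
    using Cons.prems(1)[OF that] by auto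
  have "v (a # b # w) \<noteq> 0 \<or> del q a (\<lambda>u. v (b # u)) w \<noteq> 0
      \<or> del q b (\<lambda>u. v (a # u)) w \<noteq> 0"
    by (rule ccontr) (use Cons.prems(2) in \<open>simp split: if_splits\<close>)
  then show ?case
  proof (elim disjE)
    assume "v (a # b # w) \<noteq> 0"
    then show ?thesis using Cons.prems(1) by fastforce
  next
    assume *: "del q a (\<lambda>u. v (b # u)) w \<noteq> 0"
    have "add_mset a (mset w) = N - {#b#}"
      by (rule Cons.IH[OF _ *]) (use shift in simp)
    \<comment> \<open>Multiset subtraction is truncated, so \<open>b\<close> must be shown to occur
      in \<open>N\<close>; a nonzero deletion supplies a word that witnesses it.\<close>
    moreover have "\<exists>u. v (b # u) \<noteq> 0"
    proof (rule ccontr)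
      assume "\<nexists>u. v (b # u) \<noteq> 0"
      with * show False by simp
    qed
    then have "b \<in># N" using shift by blast
    ultimately show ?thesis
      by (metis add_mset_commute insert_DiffM mset.simps(2))
  next
    assume *: "del q b (\<lambda>u. v (a # u)) w \<noteq> 0"
    have "add_mset b (mset w) = N - {#a#}"
      by (rule Cons.IH[OF _ *]) (use shift in simp)
    moreover have "\<exists>u. v (a # u) \<noteq> 0"
    proof (rule ccontr)
      assume "\<nexists>u. v (a # u) \<noteq> 0"
      with * show False by simp
    qed
    then have "a \<in># N" using shift by blast
    ultimately show ?thesis
      by (metis insert_DiffM mset.simps(2))
  qed
qed

text \<open>The recursion is expanded at the first letter \<open>c\<close> of the word. Its
  \<open>q - 1\<close> terms exchange deleted letters with \<open>c\<close>, so the induction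
  hypothesis is kept for all ordered pairs from \<open>a\<close>, \<open>b\<close>,
  \<open>c\<close>; what remains is a polynomial identity for each of the three positions of
  \<open>c\<close>.\<close>

lemma del_commute:
  assumes "a < b" "distinct (a # b # w)"
  shows "del q b (del q a v) w = q * del q a (del q b v) w"
  using assms
proof (induction w arbitrary: a b v)
  case Nil
  then show ?case by (simp add: algebra_simps)
next
  case (Cons c w)
  have IH: "del q j (del q i u) w = q * del q i (del q j u) w"
    if "i < j" "i \<in> {a,b,c}" "j \<in> {a,b,c}" for i j u
    using Cons.IH[of i j u] that Cons.prems by auto
  from Cons.prems consider "b < c" | "a < c" "c < b" | "c < a" by fastforce
  then show ?case
  proof cases
    case 1
    with Cons.prems have [simp]: "a < b" "b < c" "a < c" "\<not> b < a" "\<not> c < b" "\<not> c < a" by auto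
    show ?thesis
      by (simp add: del_add del_cmult IH) (simp add: algebra_simps)
  next
    case 2
    with Cons.prems have [simp]: "a < b" "c < b" "a < c" "\<not> b < a" "\<not> b < c" "\<not> c < a" by auto
    show ?thesis
      by (simp add: del_add del_cmult IH) (simp add: algebra_simps)
  next
    case 3
    with Cons.prems have [simp]: "a < b" "c < b" "c < a" "\<not> b < a" "\<not> b < c" "\<not> a < c" by auto
    show ?thesis
      by (simp add: del_add del_cmult IH) (simp add: algebra_simps)
  qed
qed

section \<open>Vectors supported on the arrangements of a letter set\<close>

lemma mset_eq_mset_set_iff:
  assumes "finite A"
  shows "mset w = mset_set A \<longleftrightarrow> distinct w \<and> set w = A"
  using assms permutations_of_multisetI permutations_of_multisetD permutations_of_setI
    permutations_of_setD permutations_of_set_altdef by metis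

text \<open>Combinations of arrangements are functions on all lists with restricted support, so that
  deletion maps between the spaces of different letter sets within one type.\<close>

definition arr_space :: "nat set \<Rightarrow> (nat list \<Rightarrow> real) set" where
  "arr_space A = {v. \<forall>w. v w \<noteq> 0 \<longrightarrow> mset w = mset_set A}"

lemma del_arr_space:
  assumes "finite A" "v \<in> arr_space A"
  shows "del q a v \<in> arr_space (A - {a})"
proof -
  have "mset w = mset_set (A - {a})" if "del q a v w \<noteq> 0" for w
  proof -
    have eq: "add_mset a (mset w) = mset_set A"
      by (rule del_nonzero_mset[OF _ that]) (use assms(2) in \<open>auto simp: arr_space_def\<close>)
    then have "a \<in> A"
      by (metis assms(1) elem_mset_set union_single_eq_member)
    then show ?thesis
      using arg_cong[OF eq, of "\<lambda>N. N - {#a#}"] assms(1) by (simp add: mset_set_Diff)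
  qed
  then show ?thesis by (auto simp: arr_space_def)
qed

lemma del_arr_space_notin:
  assumes "finite A" "v \<in> arr_space A" "a \<notin> A"
  shows "del q a v w = 0"
proof (rule ccontr)
  assume "del q a v w \<noteq> 0"
  then have "add_mset a (mset w) = mset_set A"
    using assms(2) by (intro del_nonzero_mset) (auto simp: arr_space_def)
  then show False
    using assms by (metis elem_mset_set union_single_eq_member)
qed

text \<open>Unless \<open>a\<close> and \<open>b\<close> lie in \<open>A\<close> and
  \<open>w\<close> arranges the other letters, both sides vanish; in the remaining case
  \<open>del_commute\<close> applies.\<close>

lemma del_commute_arr_space:
  assumes "finite A" "v \<in> arr_space A" "a < b"
  shows "del q b (del q a v) w = q * del q a (del q b v) w"
proof (cases "mset w = mset_set (A - {a} - {b}) \<and> a \<in> A \<and> b \<in> A")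
  case True
  then have "mset w = mset_set (A - {a} - {b})" by blast
  then have "set w = A - {a} - {b}" "distinct w"
    using assms(1) by (simp_all add: mset_eq_mset_set_iff)
  then have "distinct (a # b # w)"
    using assms(3) by auto
  then show ?thesis using assms del_commute by blast
next
  case False
  have 1: "del q b (del q a v) \<in> arr_space (A - {a} - {b})"
    "del q a (del q b v) \<in> arr_space (A - {b} - {a})"
    using assms by (auto intro!: del_arr_space)
  have z: "del q a v = (\<lambda>w. 0)" if "a \<notin> A" for a
    using del_arr_space_notin[OF assms(1,2) that] by auto
  consider "a \<notin> A" | "b \<notin> A" | "mset w \<noteq> mset_set (A - {a} - {b})" using False by blast
  then show ?thesis
  proof cases
    case 3
    moreover have "A - {b} - {a} = A - {a} - {b}" by auto
    ultimately have "del q b (del q a v) w = 0" "del q a (del q b v) w = 0"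
      using 1 unfolding arr_space_def by force+
    then show ?thesis by simp
  next
    case 1
    have "del q a (del q b v) w = 0"
      by (rule del_arr_space_notin[of "A - {b}"]) (use assms 1 in \<open>auto intro: del_arr_space\<close>)
    then show ?thesis using z[OF 1] by simp
  next
    case 2
    have "del q b (del q a v) w = 0"
      by (rule del_arr_space_notin[of "A - {a}"]) (use assms 2 in \<open>auto intro: del_arr_space\<close>)
    then show ?thesis using z[OF 2] by simp
  qed
qed

section \<open>The stationary vector of a full word space\<close>

definition del_kernel :: "real \<Rightarrow> nat set \<Rightarrow> (nat list \<Rightarrow> real) set" where
  "del_kernel q B = {v \<in> arr_space B. \<forall>a w. del q a v w = 0}"

definition juxt :: "nat \<Rightarrow> (nat list \<Rightarrow> real) \<Rightarrow> (nat list \<Rightarrow> real) \<Rightarrow> nat list \<Rightarrow> real" where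
  "juxt m f g w = f (take m w) * g (drop m w)"

text \<open>The recursion of \<open>del\<close> runs through the first block before it reaches
  \<open>g\<close>. It can touch \<open>g\<close> only by deleting a letter from it, which gives
  zero, so all surviving terms delete from \<open>f\<close>.\<close>

lemma del_juxt:
  assumes "\<And>a w. del q a g w = 0"
  shows "del q a (juxt m f g) w = (case m of 0 \<Rightarrow> 0 | Suc k \<Rightarrow> juxt k (del q a f) g w)"
proof (induction m arbitrary: a f w)
  case 0
  then show ?case by (simp add: juxt_def[abs_def] del_cmult assms)
next
  case (Suc m)
  have shift: "(\<lambda>u. juxt (Suc m) f g (b # u)) = juxt m (\<lambda>u. f (b # u)) g" for b
    by (simp add: juxt_def fun_eq_iff)
  show ?case
  proof (cases w)
    case Nil
    then show ?thesis by (simp add: juxt_def)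
  next
    case (Cons b u)
    show ?thesis
      unfolding Cons del.simps shift Suc.IH
      by (cases m) (simp_all add: juxt_def algebra_simps)
  qed
qed

section \<open>The top eigenvalue under removal of a letter\<close>

definition num_above :: "nat set \<Rightarrow> nat \<Rightarrow> nat" where
  "num_above S a = card {b \<in> S. a < b}"

text \<open>The largest of the \<open>\<lambda>\<^sub>T\<close> with \<open>T \<subseteq> S\<close>, at \<open>T = S\<close>, in terms of \<open>y\<^sub>i = x\<^sub>i / q\<^bsup>n-i\<^esup>\<close>.\<close>

definition top_eigenvalue :: "real \<Rightarrow> (nat \<Rightarrow> real) \<Rightarrow> nat set \<Rightarrow> real" where
  "top_eigenvalue q y S = (\<Sum>a\<in>S. y a * q ^ num_above S a)"

text \<open>
  The weights for which deleting \<open>c\<close> intertwines the library operator with weights \<open>y\<close> and the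
  one on the remaining letters, shifted by \<open>y c\<close>; the value at \<open>b = c\<close> is irrelevant.
\<close>

definition transfer :: "real \<Rightarrow> nat \<Rightarrow> (nat \<Rightarrow> real) \<Rightarrow> nat \<Rightarrow> real" where
  "transfer q c y b = (if b < c then q * y b else y b + (q - 1) * y c)"

lemma transfer_pos:
  assumes "q \<ge> 1" "y b > 0" "y c > 0"
  shows "transfer q c y b > 0"
  using assms by (auto simp: transfer_def intro: add_pos_nonneg)

lemma transfer_commute:
  assumes "a \<noteq> b" "c \<noteq> a" "c \<noteq> b"
  shows "transfer q a (transfer q b y) c = transfer q b (transfer q a y) c"
  using assms unfolding transfer_def by (auto simp: algebra_simps)

lemma num_above_remove:
  assumes "finite S" "a \<in> S"
  shows "num_above S b = num_above (S - {a}) b + (if b < a then 1 else 0)"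
proof -
  have "{c \<in> S. b < c} = {c \<in> S - {a}. b < c} \<union> (if b < a then {a} else {})"
    using assms by auto
  then show ?thesis
    using assms unfolding num_above_def by (auto simp: card_insert_if)
qed

text \<open>The exponents \<open>num_above U b\<close> run through
  \<open>0, ..., card U - 1\<close>, so this is a geometric sum. Inserting a new minimum leaves the
  old exponents alone and adds the exponent \<open>card U\<close>.\<close>

lemma geometric_num_above:
  assumes "finite (U :: nat set)"
  shows "(q - 1) * (\<Sum>b\<in>U. q ^ num_above U b) = (q :: real) ^ card U - 1"
  using assms
proof (induction U rule: finite_linorder_min_induct)
  case empty
  then show ?case by simp
next
  case (insert b U)
  have "b \<notin> U" using insert.hyps by blast
  have "num_above (insert b U) b = card U"
    using insert.hyps by (auto simp: num_above_def intro: arg_cong[where f = card])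
  moreover have "num_above (insert b U) c = num_above U c" if "c \<in> U" for c
  proof -
    have "{d. (d = b \<or> d \<in> U) \<and> c < d} = {d \<in> U. c < d}"
      using insert.hyps that by fastforce
    then show ?thesis by (simp add: num_above_def)
  qed
  ultimately have "(\<Sum>c\<in>insert b U. q ^ num_above (insert b U) c) =
      q ^ card U + (\<Sum>c\<in>U. q ^ num_above U c)"
    using insert.hyps \<open>b \<notin> U\<close> by simp
  then show ?case
    using insert \<open>b \<notin> U\<close> by (simp add: algebra_simps)
qed

text \<open>Below \<open>c\<close> the factor \<open>q\<close> in \<open>transfer\<close> replaces
  the power lost with \<open>c\<close>. Above \<open>c\<close> the additions of
  \<open>(q - 1) * y c\<close> form a geometric sum, which together with the separate
  \<open>y c\<close> rebuilds the term of \<open>c\<close>.\<close>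

lemma top_eigenvalue_transfer:
  assumes "finite S" "c \<in> S"
  shows "top_eigenvalue q y S = y c + top_eigenvalue q (transfer q c y) (S - {c})"
proof -
  let ?S = "S - {c}"
  let ?U = "{b \<in> S. c < b}"
  have U: "?U \<subseteq> ?S" "finite ?S" using assms by auto
  have "num_above S b = num_above ?U b" if "b \<in> ?U" for b
    using that unfolding num_above_def by (auto intro!: arg_cong[where f = card])
  then have geo: "(q - 1) * (\<Sum>b\<in>?U. q ^ num_above S b) = q ^ num_above S c - 1"
    using geometric_num_above[of ?U q] assms by (simp add: num_above_def)
  have "top_eigenvalue q (transfer q c y) ?S =
      (\<Sum>b\<in>?S. y b * q ^ num_above S b + (if b \<in> ?U then (q - 1) * y c * q ^ num_above S b else 0))"
    unfolding top_eigenvalue_def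
  proof (rule sum.cong)
    fix b assume b: "b \<in> ?S"
    show "transfer q c y b * q ^ num_above ?S b =
        y b * q ^ num_above S b + (if b \<in> ?U then (q - 1) * y c * q ^ num_above S b else 0)"
      using b by (auto simp: transfer_def num_above_remove[OF assms, of b] algebra_simps)
  qed simp
  also have "\<dots> = (\<Sum>b\<in>?S. y b * q ^ num_above S b) + (\<Sum>b\<in>?U. (q - 1) * y c * q ^ num_above S b)"
    by (simp only: sum.distrib sum.inter_restrict[OF U(2), symmetric]) (use U(1) in \<open>simp add: Int_absorb1\<close>)
  also have "(\<Sum>b\<in>?U. (q - 1) * y c * q ^ num_above S b) = y c * (q ^ num_above S c - 1)"
    unfolding geo[symmetric] by (simp add: sum_distrib_left algebra_simps)
  also have "(\<Sum>b\<in>?S. y b * q ^ num_above S b) = top_eigenvalue q y S - y c * q ^ num_above S c"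
    unfolding top_eigenvalue_def using assms by (simp add: sum.remove)
  finally show ?thesis by (simp add: algebra_simps)
qed

lemma top_eigenvalue_pos:
  assumes "finite S" "S \<noteq> {}" "q > 0" "\<And>a. a \<in> S \<Longrightarrow> y a > 0"
  shows "top_eigenvalue q y S > 0"
  unfolding top_eigenvalue_def using assms by (intro sum_pos) auto

text \<open>For positive weights and \<open>q \<ge> 1\<close> this is the law of sampling the
  letters one by one: the first is \<open>a\<close> with probability proportional to its term in
  \<open>top_eigenvalue\<close>, and the rest is sampled with transferred weights. At
  \<open>q = 1\<close> it is the classical stationary law of the Tsetlin library.\<close>

fun top_eigenvector :: "real \<Rightarrow> nat set \<Rightarrow> (nat \<Rightarrow> real) \<Rightarrow> nat list \<Rightarrow> real" where
  "top_eigenvector q S y [] = (if S = {} then 1 else 0)"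
| "top_eigenvector q S y (a # w) =
     (if a \<in> S then y a * q ^ num_above S a / top_eigenvalue q y S *
        top_eigenvector q (S - {a}) (transfer q a y) w else 0)"

lemma top_eigenvector_arr_space:
  assumes "finite S"
  shows "top_eigenvector q S y \<in> arr_space S"
proof -
  have "distinct w \<and> set w = S" if "top_eigenvector q S y w \<noteq> 0" for w
    using that by (induction w arbitrary: S y) (auto split: if_splits)
  then show ?thesis
    using assms by (auto simp: arr_space_def mset_eq_mset_set_iff)
qed

text \<open>\<open>transfer_commute\<close> compares weights only away from the two removed letters,
  so weights outside \<open>S\<close> must be free to differ.\<close>

lemma top_eigenvector_cong:
  assumes "\<And>a. a \<in> S \<Longrightarrow> y a = z a"
  shows "top_eigenvector q S y w = top_eigenvector q S z w"
  using assms
proof (induction w arbitrary: S y z)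
  case (Cons a w)
  have "top_eigenvalue q y S = top_eigenvalue q z S"
    unfolding top_eigenvalue_def using Cons.prems by simp
  moreover have "top_eigenvector q (S - {a}) (transfer q a y) w =
      top_eigenvector q (S - {a}) (transfer q a z) w" if "a \<in> S"
    by (rule Cons.IH) (use Cons.prems that in \<open>simp add: transfer_def\<close>)
  ultimately show ?case using Cons.prems by simp
qed simp

text \<open>For a first letter \<open>b\<close> of \<open>S\<close> other than \<open>c\<close>, the
  word with \<open>c\<close> in front of \<open>b\<close> and the remaining terms of the recursion
  contribute in the ratio of \<open>y c\<close> to the eigenvalue left after removing
  \<open>c\<close>. By \<open>top_eigenvalue_transfer\<close> these two add up to the full
  eigenvalue, which cancels the denominator.\<close>

lemma del_top_eigenvector:
  assumes "finite S" "q \<ge> 1" "\<And>a. a \<in> S \<Longrightarrow> y a > 0" "c \<in> S"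
  shows "del q c (top_eigenvector q S y) w =
     q ^ num_above S c * top_eigenvector q (S - {c}) (transfer q c y) w"
  using assms
proof (induction w arbitrary: S y c)
  case Nil
  show ?case
  proof (cases "S = {c}")
    case True
    moreover have "num_above {c} c = 0"
      by (auto simp: num_above_def)
    ultimately show ?thesis using Nil by (auto simp: top_eigenvalue_def)
  next
    case False
    then have "S - {c} \<noteq> {}" using Nil by auto
    then show ?thesis by (simp del: Diff_eq_empty_iff)
  qed
next
  case (Cons b w)
  let ?l = "top_eigenvalue q y S" and ?m = "top_eigenvalue q (transfer q c y) (S - {c})"
  have l: "?l = y c + ?m"
    using Cons.prems by (intro top_eigenvalue_transfer) auto
  have lpos: "?l > 0"
    using Cons.prems by (intro top_eigenvalue_pos) auto
  have notin: "del q a (top_eigenvector q (T - {a}) z) w = 0" if "finite T" for a T z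
    by (rule del_arr_space_notin[of "T - {a}"]) (use that in \<open>auto intro!: top_eigenvector_arr_space\<close>)
  have notin': "del q a (top_eigenvector q (S - {c}) z) w = 0" if "a \<notin> S" for a z
    by (rule del_arr_space_notin[of "S - {c}"])
      (use that Cons.prems in \<open>auto intro!: top_eigenvector_arr_space\<close>)
  have shift: "(\<lambda>u. top_eigenvector q S y (a # u)) =
      (\<lambda>u. (if a \<in> S then y a * q ^ num_above S a / ?l else 0) *
        top_eigenvector q (S - {a}) (transfer q a y) u)" for a
    by auto
  consider "b \<notin> S" | "b = c" | "b \<in> S" "b \<noteq> c" by blast
  then show ?case
  proof cases
    case 1
    then have "b \<noteq> c" using Cons.prems by auto
    have "del q c (top_eigenvector q S y) (b # w) = 0"
      unfolding del.simps shift del_cmult using 1 by (simp add: notin')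
    then show ?thesis using 1 by simp
  next
    case 2
    have "del q c (top_eigenvector q S y) (b # w) = 0"
      unfolding del.simps shift del_cmult using 2 Cons.prems(1) by (simp add: notin)
    then show ?thesis using 2 by simp
  next
    case 3
    let ?G = "top_eigenvector q (S - {c} - {b}) (transfer q b (transfer q c y)) w"
    have mpos: "?m > 0"
      using Cons.prems 3 by (intro top_eigenvalue_pos) (auto intro: transfer_pos)
    have 1: "del q b (top_eigenvector q (S - {c}) (transfer q c y)) w =
        q ^ num_above (S - {c}) b * ?G"
      by (rule Cons.IH) (use Cons.prems 3 in \<open>auto intro: transfer_pos\<close>)
    have "del q c (top_eigenvector q (S - {b}) (transfer q b y)) w =
        q ^ num_above (S - {b}) c * top_eigenvector q (S - {b} - {c}) (transfer q c (transfer q b y)) w"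
      by (rule Cons.IH) (use Cons.prems 3 in \<open>auto intro: transfer_pos\<close>)
    also have "top_eigenvector q (S - {b} - {c}) (transfer q c (transfer q b y)) w = ?G"
    proof -
      have "S - {b} - {c} = S - {c} - {b}" by auto
      moreover have "top_eigenvector q (S - {c} - {b}) (transfer q c (transfer q b y)) w = ?G"
        by (rule top_eigenvector_cong) (use 3 in \<open>auto intro: transfer_commute\<close>)
      ultimately show ?thesis by simp
    qed
    finally have 2: "del q c (top_eigenvector q (S - {b}) (transfer q b y)) w =
        q ^ num_above (S - {b}) c * ?G" .
    have first: "top_eigenvector q S y (c # b # w) = y c * q ^ num_above S c / ?l *
        (transfer q c y b * q ^ num_above (S - {c}) b / ?m * ?G)"
      using 3 Cons.prems by simp
    have nb: "num_above S b = num_above (S - {c}) b + (if b < c then 1 else 0)"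
      "num_above S c = num_above (S - {b}) c + (if c < b then 1 else 0)"
      by (rule num_above_remove; use Cons.prems 3 in simp)+
    have goal: "top_eigenvector q (S - {c}) (transfer q c y) (b # w) =
        transfer q c y b * q ^ num_above (S - {c}) b / ?m * ?G"
      using 3 by simp
    \<comment> \<open>If \<open>c < b\<close>, the term deleting \<open>b\<close> adds
      \<open>(q - 1) * y c\<close> to \<open>y b\<close>, producing the transferred weight; if
      \<open>b < c\<close>, the factor \<open>q\<close> comes from \<open>c\<close> being counted in
      \<open>num_above S b\<close>.\<close>
    have lhs: "del q c (top_eigenvector q S y) (b # w) =
       y c * q ^ num_above S c / ?l * (transfer q c y b * q ^ num_above (S - {c}) b / ?m * ?G) +
       q ^ num_above S c * (transfer q c y b * q ^ num_above (S - {c}) b) / ?l * ?G"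
    proof (cases "c < b")
      case True
      then have [simp]: "q ^ num_above S b = q ^ num_above (S - {c}) b"
        "q ^ num_above S c = q * q ^ num_above (S - {b}) c"
        "transfer q c y b = y b + (q - 1) * y c"
        using nb by (simp_all add: transfer_def)
      show ?thesis
        unfolding del.simps first unfolding shift del_cmult 1 2
        using True 3 Cons.prems(4) by (simp add: divide_inverse algebra_simps)
    next
      case False
      then have [simp]: "q ^ num_above S b = q * q ^ num_above (S - {c}) b"
        "q ^ num_above S c = q ^ num_above (S - {b}) c"
        "transfer q c y b = q * y b"
        using nb 3 by (simp_all add: transfer_def)
      show ?thesis
        unfolding del.simps first unfolding shift del_cmult 1 2
        using False 3 Cons.prems(4) by (simp add: divide_inverse algebra_simps)
    qed
    also have "\<dots> = q ^ num_above S c * (transfer q c y b * q ^ num_above (S - {c}) b / ?m * ?G) * ((y c + ?m) / ?l)"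
      using lpos mpos by (simp add: field_simps)
    finally show ?thesis unfolding goal using l lpos by simp
  qed
qed

text \<open>The value \<open>0\<close> at the empty word fits the eigenvalue \<open>0\<close> of
  \<open>S = {}\<close>.\<close>

definition lib_op :: "real \<Rightarrow> (nat \<Rightarrow> real) \<Rightarrow> (nat list \<Rightarrow> real) \<Rightarrow> nat list \<Rightarrow> real" where
  "lib_op q y v w = (case w of [] \<Rightarrow> 0 | a # u \<Rightarrow> y a * del q a v u)"

text \<open>On a word \<open>a # u\<close>, deleting \<open>a\<close> from the first block gives the
  same product as the recursion of \<open>top_eigenvector\<close>, except for the division by the
  eigenvalue. For \<open>S = {}\<close> the vector is \<open>g\<close>, which all deletions
  kill.\<close>

lemma lib_op_eigenvector:
  assumes "finite S" "q \<ge> 1" "\<And>a. a \<in> S \<Longrightarrow> y a > 0" "g \<in> del_kernel q B"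
  shows "lib_op q y (juxt (card S) (top_eigenvector q S y) g) w =
     top_eigenvalue q y S * juxt (card S) (top_eigenvector q S y) g w"
proof (cases "S = {}")
  case True
  then show ?thesis
    using assms by (auto simp: lib_op_def top_eigenvalue_def del_juxt del_kernel_def split: list.split)
next
  case False
  then obtain k where k: "card S = Suc k"
    using assms(1) by (metis card_gt_0_iff gr0_conv_Suc)
  have "top_eigenvalue q y S > 0"
    using assms False by (intro top_eigenvalue_pos) auto
  moreover have "del q a (top_eigenvector q S y) u = 0" if "a \<notin> S" for a u
    using assms that by (auto intro: del_arr_space_notin[OF _ top_eigenvector_arr_space])
  ultimately show ?thesis
    using assms False k
    by (cases w) (auto simp: lib_op_def del_juxt del_kernel_def juxt_def del_top_eigenvector)
qed

section \<open>Juxtaposition eigenvectors\<close>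

fun dels :: "real \<Rightarrow> nat list \<Rightarrow> (nat list \<Rightarrow> real) \<Rightarrow> nat list \<Rightarrow> real" where
  "dels q [] v = v"
| "dels q (a # as) v = dels q as (del q a v)"

text \<open>
  Deleting in decreasing order makes the powers of \<open>q\<close> in \<open>del_top_eigenvector\<close> trivial.
\<close>

definition desc :: "nat set \<Rightarrow> nat list" where
  "desc S = rev (sorted_list_of_set S)"

definition eigenvec ::
    "real \<Rightarrow> (nat \<Rightarrow> real) \<Rightarrow> nat set \<Rightarrow> (nat list \<Rightarrow> real) \<Rightarrow> nat list \<Rightarrow> real" where
  "eigenvec q y S g = juxt (card S) (top_eigenvector q S y) g"

lemma desc_empty [simp]: "desc {} = []"
  by (simp add: desc_def)

lemma desc_set:
  assumes "finite S"
  shows "distinct (desc S)" "set (desc S) = S" "length (desc S) = card S"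
  using assms by (simp_all add: desc_def)

lemma desc_insert_max:
  assumes "finite S" "\<And>a. a \<in> S \<Longrightarrow> a < b"
  shows "desc (insert b S) = b # desc S"
proof -
  have "sorted_list_of_set (insert b S) = sorted_list_of_set S @ [b]"
  proof (rule sorted_distinct_set_unique)
    show "sorted (sorted_list_of_set S @ [b])" "distinct (sorted_list_of_set S @ [b])"
      "set (sorted_list_of_set (insert b S)) = set (sorted_list_of_set S @ [b])"
      using assms by (auto simp: sorted_append intro: less_imp_le simp del: sorted_list_of_set_insert_remove)
  qed (use assms in \<open>auto simp del: sorted_list_of_set_insert_remove\<close>)
  then show ?thesis by (simp add: desc_def)
qed

lemma dels_append: "dels q (as @ bs) v = dels q bs (dels q as v)"
  by (induction as arbitrary: v) auto

lemma dels_zero: "dels q as (\<lambda>w. 0) = (\<lambda>w. 0)"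
proof (induction as)
  case (Cons a as)
  have "del q a (\<lambda>w. 0) = (\<lambda>w. 0)" by (simp add: fun_eq_iff)
  then show ?case using Cons by simp
qed simp

lemma dels_cmult: "dels q as (\<lambda>w. c * f w) = (\<lambda>w. c * dels q as f w)"
proof (induction as arbitrary: f)
  case (Cons a as)
  have "del q a (\<lambda>w. c * f w) = (\<lambda>w. c * del q a f w)" by (simp add: fun_eq_iff del_cmult)
  then show ?case using Cons by simp
qed simp

lemma dels_diff: "dels q as (\<lambda>w. f w - g w) = (\<lambda>w. dels q as f w - dels q as g w)"
proof (induction as arbitrary: f g)
  case (Cons a as)
  have "del q a (\<lambda>w. f w - g w) = (\<lambda>w. del q a f w - del q a g w)" by (simp add: fun_eq_iff del_diff)
  then show ?case using Cons by simp
qed simp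

lemma dels_sum: "dels q as (\<lambda>w. \<Sum>i\<in>I. f i w) = (\<lambda>w. \<Sum>i\<in>I. dels q as (f i) w)"
proof (induction as arbitrary: f)
  case (Cons a as)
  have "del q a (\<lambda>w. \<Sum>i\<in>I. f i w) = (\<lambda>w. \<Sum>i\<in>I. del q a (f i) w)" by (simp add: fun_eq_iff del_sum)
  then show ?case using Cons by simp
qed simp

lemma dels_arr_space:
  assumes "finite A" "v \<in> arr_space A"
  shows "dels q as v \<in> arr_space (A - set as)"
  using assms
proof (induction as arbitrary: A v)
  case (Cons a as)
  have "dels q as (del q a v) \<in> arr_space (A - {a} - set as)"
    by (rule Cons.IH) (use Cons.prems in \<open>auto intro: del_arr_space\<close>)
  moreover have "A - {a} - set as = A - set (a # as)" by auto
  ultimately show ?case by simp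
qed simp

text \<open>Each exchange of two deletions costs a factor \<open>q\<close> or \<open>1 / q\<close>;
  for transporting vanishing it is enough that the total factor is nonzero.\<close>

lemma dels_del_commute:
  assumes "finite A" "v \<in> arr_space A" "a \<notin> set as" "q \<noteq> 0"
  shows "\<exists>c. c \<noteq> 0 \<and> del q a (dels q as v) = (\<lambda>w. c * dels q as (del q a v) w)"
  using assms
proof (induction as arbitrary: A v)
  case Nil
  then show ?case by (intro exI[of _ 1]) simp
next
  case (Cons b as)
  have "\<exists>c. c \<noteq> 0 \<and> del q a (dels q as (del q b v)) = (\<lambda>w. c * dels q as (del q a (del q b v)) w)"
    by (rule Cons.IH[of "A - {b}"]) (use Cons.prems in \<open>auto intro: del_arr_space\<close>)
  then obtain c where c: "c \<noteq> 0"
    "del q a (dels q as (del q b v)) = (\<lambda>w. c * dels q as (del q a (del q b v)) w)" by blast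
  have "\<exists>d. d \<noteq> 0 \<and> del q a (del q b v) = (\<lambda>w. d * del q b (del q a v) w)"
  proof (cases "a < b")
    case True
    then show ?thesis
      using del_commute_arr_space[OF Cons.prems(1,2), of a b q] \<open>q \<noteq> 0\<close>
      by (intro exI[of _ "1 / q"]) (simp add: fun_eq_iff)
  next
    case False
    then have "b < a" using Cons.prems by auto
    then show ?thesis
      using del_commute_arr_space[OF Cons.prems(1,2), of b a q] \<open>q \<noteq> 0\<close>
      by (intro exI[of _ q]) (simp add: fun_eq_iff)
  qed
  then obtain d where "d \<noteq> 0" "del q a (del q b v) = (\<lambda>w. d * del q b (del q a v) w)" by blast
  then show ?case
    using c by (intro exI[of _ "c * d"]) (simp add: dels_cmult mult.assoc)
qed

lemma insort_split:
  "\<exists>ys zs. xs = ys @ zs \<and> insort a xs = ys @ a # zs"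
proof (induction xs)
  case (Cons b xs)
  then obtain ys zs where "xs = ys @ zs" "insort a xs = ys @ a # zs" by blast
  then show ?case
  proof (cases "a \<le> b")
    case True
    then show ?thesis by (intro exI[of _ "[]"] exI[of _ "b # xs"]) simp
  next
    case False
    then show ?thesis
      using \<open>xs = ys @ zs\<close> \<open>insort a xs = ys @ a # zs\<close>
      by (intro exI[of _ "b # ys"] exI[of _ zs]) simp
  qed
qed simp

text \<open>In \<open>desc (insert a S)\<close> the letter \<open>a\<close> sits between the larger
  and the smaller letters. Moving its deletion past the smaller ones, to the end, changes the result
  by a nonzero factor only.\<close>

lemma del_dels_desc_zero:
  assumes "finite A" "v \<in> arr_space A" "finite S" "a \<notin> S" "q \<noteq> 0"
    and "dels q (desc (insert a S)) v = (\<lambda>w. 0)"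
  shows "del q a (dels q (desc S) v) = (\<lambda>w. 0)"
proof -
  have "sorted_list_of_set (insert a S) = insort a (sorted_list_of_set S)"
    using assms by (simp add: sorted_list_of_set_insert)
  then obtain ys zs where "sorted_list_of_set S = ys @ zs"
    "sorted_list_of_set (insert a S) = ys @ a # zs"
    using insort_split by metis
  then have d: "desc S = rev zs @ rev ys" "desc (insert a S) = rev zs @ a # rev ys"
    by (simp_all add: desc_def)
  let ?u = "dels q (rev zs) v"
  have u: "?u \<in> arr_space (A - set (rev zs))"
    using assms by (intro dels_arr_space)
  have "a \<notin> set (rev ys)"
    using assms(3,4) desc_set(2)[of S] d by auto
  then obtain c where "del q a (dels q (rev ys) ?u) = (\<lambda>w. c * dels q (rev ys) (del q a ?u) w)"
    using dels_del_commute[OF _ u, of a "rev ys" q] assms by auto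
  then show ?thesis
    using assms(6) by (simp add: d dels_append)
qed

section \<open>Deletions applied to juxtaposition vectors\<close>

lemma eigenvec_add: "eigenvec q y S (\<lambda>w. f w + g w) w = eigenvec q y S f w + eigenvec q y S g w"
  by (simp add: eigenvec_def juxt_def algebra_simps)

lemma eigenvec_zero: "eigenvec q y S (\<lambda>w. 0) = (\<lambda>w. 0)"
  by (simp add: eigenvec_def juxt_def fun_eq_iff)

lemma eigenvec_sum:
  "eigenvec q y S (\<lambda>w. \<Sum>i\<in>I. c i * f i w) w = (\<Sum>i\<in>I. c i * eigenvec q y S (f i) w)"
  by (simp add: eigenvec_def juxt_def sum_distrib_left algebra_simps)

lemma eigenvec_arr_space:
  assumes "finite A" "S \<subseteq> A" "g \<in> arr_space (A - S)"
  shows "eigenvec q y S g \<in> arr_space A"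
proof -
  have fin: "finite S" using assms finite_subset by blast
  have "mset w = mset_set A" if "eigenvec q y S g w \<noteq> 0" for w
  proof -
    have "mset (take (card S) w) = mset_set S" "mset (drop (card S) w) = mset_set (A - S)"
      using that assms(3) top_eigenvector_arr_space[OF fin, of q y]
      by (auto simp: eigenvec_def juxt_def arr_space_def)
    moreover have "mset w = mset (take (card S) w) + mset (drop (card S) w)"
      by (metis append_take_drop_id mset_append)
    moreover have "mset_set A = mset_set S + mset_set (A - S)"
      using assms fin by (simp add: mset_set_Diff subset_imp_msubset_mset_set)
    ultimately show ?thesis by simp
  qed
  then show ?thesis by (auto simp: arr_space_def)
qed

lemma del_eigenvec:
  assumes "finite S" "q \<ge> 1" "\<And>a. a \<in> S \<Longrightarrow> y a > 0" "g \<in> del_kernel q B"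
  shows "del q a (eigenvec q y S g) =
    (\<lambda>w. if a \<in> S then q ^ num_above S a * eigenvec q (transfer q a y) (S - {a}) g w else 0)"
proof (cases "a \<in> S")
  case True
  then obtain k where k: "card S = Suc k"
    using assms(1) by (metis card_gt_0_iff gr0_conv_Suc empty_iff)
  then have "card (S - {a}) = k"
    using True assms(1) by simp
  then show ?thesis
    using assms True k
    by (auto simp: fun_eq_iff eigenvec_def del_juxt del_kernel_def juxt_def del_top_eigenvector)
next
  case False
  have "del q a (top_eigenvector q S y) u = 0" for u
    using assms(1) False by (intro del_arr_space_notin[OF _ top_eigenvector_arr_space])
  then show ?thesis
    using assms False
    by (auto simp: fun_eq_iff eigenvec_def del_juxt del_kernel_def juxt_def split: nat.split)
qed

text \<open>Letters of \<open>S\<close> met on the way only shrink \<open>S\<close> and change the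
  weights, up to a scalar; the first letter outside the current set kills the vector.\<close>

lemma dels_eigenvec_zero:
  assumes "finite S" "q \<ge> 1" "\<And>a. a \<in> S \<Longrightarrow> y a > 0" "g \<in> del_kernel q B"
    and "distinct as" "\<not> set as \<subseteq> S"
  shows "dels q as (eigenvec q y S g) = (\<lambda>w. 0)"
  using assms
proof (induction as arbitrary: S y)
  case (Cons a as)
  show ?case
  proof (cases "a \<in> S")
    case True
    have "dels q as (eigenvec q (transfer q a y) (S - {a}) g) = (\<lambda>w. 0)"
      by (rule Cons.IH) (use Cons.prems True in \<open>auto intro: transfer_pos\<close>)
    then show ?thesis
      using True by (simp add: del_eigenvec[OF Cons.prems(1-4)] dels_cmult)
  next
    case False
    then show ?thesis by (simp add: del_eigenvec[OF Cons.prems(1-4)] dels_zero)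
  qed
qed simp

text \<open>Each deleted letter is the current maximum and contributes the factor
  \<open>q ^ 0\<close>; after the last one the first block is the empty word with value 1.\<close>

lemma dels_desc_eigenvec:
  assumes "finite S" "q \<ge> 1" "\<And>a. a \<in> S \<Longrightarrow> y a > 0" "g \<in> del_kernel q B"
  shows "dels q (desc S) (eigenvec q y S g) = g"
  using assms
proof (induction S arbitrary: y rule: finite_linorder_max_induct)
  case empty
  then show ?case by (simp add: eigenvec_def juxt_def fun_eq_iff)
next
  case (insert b S)
  have b: "b \<notin> S" "finite (insert b S)" using insert.hyps by auto
  have na: "num_above (insert b S) b = 0"
    using insert.hyps by (auto simp: num_above_def)
  have "desc (insert b S) = b # desc S"
    using insert.hyps by (intro desc_insert_max) auto
  then have "dels q (desc (insert b S)) (eigenvec q y (insert b S) g) =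
      dels q (desc S) (del q b (eigenvec q y (insert b S) g))"
    by simp
  also have "\<dots> = dels q (desc S) (eigenvec q (transfer q b y) S g)"
    using del_eigenvec[OF b(2) insert.prems, where a = b] b na by simp
  also have "\<dots> = g"
    by (rule insert.IH) (use insert.prems in \<open>auto intro: transfer_pos\<close>)
  finally show ?case .
qed

text \<open>The system is triangular for inclusion: deleting the letters of \<open>S\<close> kills
  the terms of all \<open>T\<close> not containing \<open>S\<close> and turns that of
  \<open>S\<close> into \<open>u S\<close>. The terms of larger \<open>T\<close> vanish by induction
  from \<open>A\<close> downwards.\<close>

lemma eigenvec_sum_unique:
  assumes "finite A" "q \<ge> 1" "\<And>a. a \<in> A \<Longrightarrow> y a > 0"
    and u: "\<And>S. S \<subseteq> A \<Longrightarrow> u S \<in> del_kernel q (A - S)"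
    and z: "\<And>w. (\<Sum>S\<in>Pow A. eigenvec q y S (u S) w) = 0"
    and "S \<subseteq> A"
  shows "u S = (\<lambda>w. 0)"
  using \<open>S \<subseteq> A\<close>
proof (induction S rule: measure_induct_rule[of "\<lambda>S. card A - card S"])
  case (less S)
  have finS: "finite S" using less.prems assms(1) finite_subset by blast
  have 0: "dels q (desc S) (eigenvec q y T (u T)) w = 0" if T: "T \<in> Pow A - {S}" for T w
  proof (cases "S \<subseteq> T")
    case True
    then have "card S < card T" "card T \<le> card A"
      using T assms(1) by (auto intro!: psubset_card_mono card_mono intro: finite_subset)
    then have "u T = (\<lambda>w. 0)"
      using less.IH[of T] T by auto
    then have "eigenvec q y T (u T) = (\<lambda>w. 0)" by (simp add: eigenvec_zero)
    then show ?thesis by (simp add: dels_zero)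
  next
    case False
    have "dels q (desc S) (eigenvec q y T (u T)) = (\<lambda>w. 0)"
      by (rule dels_eigenvec_zero[OF _ _ _ u])
        (use T False assms(1-3) finS in \<open>auto simp: desc_set intro: finite_subset\<close>)
    then show ?thesis by simp
  qed
  have "(\<lambda>w. 0) = dels q (desc S) (\<lambda>w. \<Sum>T\<in>Pow A. eigenvec q y T (u T) w)"
    using z by (simp add: dels_zero)
  also have "\<dots> = (\<lambda>w. \<Sum>T\<in>Pow A. dels q (desc S) (eigenvec q y T (u T)) w)"
    by (rule dels_sum)
  also have "\<dots> = dels q (desc S) (eigenvec q y S (u S))"
    using less.prems assms(1) 0 by (simp add: fun_eq_iff sum.remove[of "Pow A" S])
  also have "\<dots> = u S"
    by (rule dels_desc_eigenvec[OF finS _ _ u]) (use assms(2,3) less.prems in auto)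
  finally show ?case by simp
qed

text \<open>
  Induction on \<open>k\<close>: if deleting any \<open>k + 1\<close> letters kills \<open>v\<close>, then deleting the \<open>k\<close> letters of \<open>S\<close>
  gives an element of the kernel, and subtracting the corresponding juxtapositions leaves a
  vector that is killed by deleting any \<open>k\<close> letters.
\<close>

lemma eigenvec_sum_exists:
  assumes "finite A" "q \<ge> 1" "\<And>a. a \<in> A \<Longrightarrow> y a > 0"
    and "v \<in> arr_space A"
    and "\<And>S. S \<subseteq> A \<Longrightarrow> card S = k \<Longrightarrow> dels q (desc S) v = (\<lambda>w. 0)"
  shows "\<exists>u. (\<forall>S. S \<subseteq> A \<longrightarrow> u S \<in> del_kernel q (A - S)) \<and>
    v = (\<lambda>w. \<Sum>S\<in>Pow A. eigenvec q y S (u S) w)"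
  using assms(4,5)
proof (induction k arbitrary: v)
  case 0
  have "v = (\<lambda>w. 0)" using 0(2)[of "{}"] by simp
  then show ?case
    by (intro exI[of _ "\<lambda>S w. 0"]) (simp add: eigenvec_zero del_kernel_def arr_space_def)
next
  case (Suc k)
  define z where "z S = (if card S = k then dels q (desc S) v else (\<lambda>w. 0))" for S
  have finS: "finite S" if "S \<subseteq> A" for S using that assms(1) finite_subset by blast
  have z: "z S \<in> del_kernel q (A - S)" if S: "S \<subseteq> A" for S
  proof (cases "card S = k")
    case True
    have d: "dels q (desc S) v \<in> arr_space (A - S)"
      using dels_arr_space[OF assms(1) Suc.prems(1), of q "desc S"] desc_set(2) finS[OF S] by simp
    moreover have "del q a (dels q (desc S) v) w = 0" for a w
    proof (cases "a \<in> A - S")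
      case True
      then have "dels q (desc (insert a S)) v = (\<lambda>w. 0)"
        using S \<open>card S = k\<close> finS[OF S] by (intro Suc.prems(2)) auto
      then show ?thesis
        using del_dels_desc_zero[OF assms(1) Suc.prems(1) finS[OF S], of a q] True assms(2) by auto
    next
      case False
      then show ?thesis using assms(1) d by (intro del_arr_space_notin[of "A - S"]) auto
    qed
    ultimately show ?thesis using True by (simp add: z_def del_kernel_def)
  next
    case False
    then show ?thesis by (simp add: z_def del_kernel_def arr_space_def)
  qed
  define r where "r = (\<lambda>w. v w - (\<Sum>S\<in>Pow A. eigenvec q y S (z S) w))"
  have "\<exists>u. (\<forall>S. S \<subseteq> A \<longrightarrow> u S \<in> del_kernel q (A - S)) \<and>
    r = (\<lambda>w. \<Sum>S\<in>Pow A. eigenvec q y S (u S) w)"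
  proof (rule Suc.IH)
    have "mset w = mset_set A" if "r w \<noteq> 0" for w
    proof (rule ccontr)
      assume ne: "mset w \<noteq> mset_set A"
      then have "eigenvec q y S (z S) w = 0" if "S \<subseteq> A" for S
        using eigenvec_arr_space[OF assms(1) that, of "z S" q y] z[OF that]
        by (auto simp: arr_space_def del_kernel_def)
      moreover have "v w = 0" using ne Suc.prems(1) by (auto simp: arr_space_def)
      ultimately show False using that by (simp add: r_def)
    qed
    then show "r \<in> arr_space A" by (simp add: arr_space_def)
  next
    fix T assume T: "T \<subseteq> A" "card T = k"
    \<comment> \<open>Among sets of size \<open>k\<close> only \<open>T\<close> itself contains
      \<open>T\<close>, so the deletions along \<open>desc T\<close> kill every other juxtaposition;
      sets of other sizes have \<open>z S = 0\<close>.\<close>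
    have "dels q (desc T) (eigenvec q y S (z S)) w = (if S = T then dels q (desc T) v w else 0)"
      if S: "S \<in> Pow A" for S w
    proof (cases "S = T")
      case True
      have "dels q (desc T) (eigenvec q y T (z T)) = z T"
        by (rule dels_desc_eigenvec[OF finS[OF T(1)] _ _ z]) (use assms(2,3) T in auto)
      then show ?thesis using True T by (simp add: z_def)
    next
      case False
      have "dels q (desc T) (eigenvec q y S (z S)) = (\<lambda>w. 0)"
      proof (cases "card S = k")
        case True
        then have "\<not> T \<subseteq> S" using False T finS S by (metis PowD card_subset_eq)
        then show ?thesis
          by (intro dels_eigenvec_zero[OF _ _ _ z])
            (use S T finS assms(2,3) in \<open>auto simp: desc_set\<close>)
      next
        case False
        then have "eigenvec q y S (z S) = (\<lambda>w. 0)" by (simp add: z_def eigenvec_zero)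
        then show ?thesis by (simp add: dels_zero)
      qed
      then show ?thesis using False by simp
    qed
    then show "dels q (desc T) r = (\<lambda>w. 0)"
      using T assms(1) unfolding r_def dels_diff dels_sum by (simp add: sum.delta)
  qed
  then obtain u where u: "\<And>S. S \<subseteq> A \<Longrightarrow> u S \<in> del_kernel q (A - S)"
    "r = (\<lambda>w. \<Sum>S\<in>Pow A. eigenvec q y S (u S) w)" by blast
  have "(\<lambda>w. u S w + z S w) \<in> del_kernel q (A - S)" if "S \<subseteq> A" for S
    using u(1)[OF that] z[OF that]
    by (auto simp: del_kernel_def arr_space_def del_add) (metis add_0)
  moreover have "v w = (\<Sum>S\<in>Pow A. eigenvec q y S (\<lambda>w. u S w + z S w) w)" for w
    using fun_cong[OF u(2), of w] by (simp add: r_def eigenvec_add sum.distrib)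
  ultimately show ?case
    by (intro exI[of _ "\<lambda>S w. u S w + z S w"]) auto
qed

section \<open>Bases and their cardinalities\<close>

interpretation arr: vector_space "\<lambda>(c :: real) (f :: nat list \<Rightarrow> real) w. c * f w"
  by unfold_locales (auto simp: fun_eq_iff algebra_simps)

lemma sum_fun_apply: "(\<Sum>i\<in>I. f i) w = (\<Sum>i\<in>I. (f i w :: real))"
  by (induction I rule: infinite_finite_induct) auto

section \<open>The basis of words and bases of the kernels\<close>

definition word_delta :: "nat list \<Rightarrow> nat list \<Rightarrow> real" where
  "word_delta w = (\<lambda>u. if u = w then 1 else 0)"

lemma inj_word_delta: "inj_on word_delta X"
  by (rule inj_onI) (metis word_delta_def zero_neq_one)

lemma arr_space_expand:
  assumes "finite A" "v \<in> arr_space A"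
  shows "v = (\<lambda>u. \<Sum>w\<in>permutations_of_set A. v w * word_delta w u)"
proof
  fix u
  have "v u = 0" if "u \<notin> permutations_of_set A"
    using that assms by (auto simp: arr_space_def permutations_of_set_def mset_eq_mset_set_iff)
  then show "v u = (\<Sum>w\<in>permutations_of_set A. v w * word_delta w u)"
    using assms(1) by (auto simp: word_delta_def sum.delta' if_distrib cong: if_cong)
qed

lemma arr_subspace_arr_space: "arr.subspace (arr_space A)"
  by (rule arr.subspaceI) (auto simp: arr_space_def, metis add_0)

lemma arr_subspace_del_kernel: "arr.subspace (del_kernel q A)"
proof -
  have "arr.subspace {v. \<forall>a w. del q a v w = 0}"
    by (rule arr.subspaceI) (auto simp: del_add del_cmult plus_fun_def zero_fun_def)
  then have "arr.subspace (arr_space A \<inter> {v. \<forall>a w. del q a v w = 0})"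
    using arr_subspace_arr_space arr.subspace_inter by blast
  then show ?thesis
    by (simp add: del_kernel_def Collect_conj_eq)
qed

lemma arr_space_span:
  assumes "finite A"
  shows "arr_space A = arr.span (word_delta ` permutations_of_set A)"
proof
  show "arr.span (word_delta ` permutations_of_set A) \<subseteq> arr_space A"
    by (rule arr.span_minimal[OF _ arr_subspace_arr_space])
      (use assms in \<open>auto simp: word_delta_def arr_space_def permutations_of_set_def
        mset_eq_mset_set_iff split: if_splits\<close>)
  show "arr_space A \<subseteq> arr.span (word_delta ` permutations_of_set A)"
  proof
    fix v assume "v \<in> arr_space A"
    then have "v = (\<Sum>w\<in>permutations_of_set A. (\<lambda>u. v w * word_delta w u))"
      using arr_space_expand[OF assms] by (simp add: fun_eq_iff sum_fun_apply)
    also have "\<dots> \<in> arr.span (word_delta ` permutations_of_set A)"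
      by (intro arr.span_sum arr.span_scale arr.span_base imageI)
    finally show "v \<in> arr.span (word_delta ` permutations_of_set A)" .
  qed
qed

lemma independent_word_delta:
  assumes "finite X"
  shows "arr.independent (word_delta ` X)"
proof (rule arr.independent_if_scalars_zero)
  fix f x
  assume 0: "(\<Sum>x\<in>word_delta ` X. (\<lambda>w. f x * x w)) = 0" and "x \<in> word_delta ` X"
  then obtain u where u: "u \<in> X" "x = word_delta u" by blast
  have "0 = (\<Sum>x\<in>word_delta ` X. (\<lambda>w. f x * x w)) u"
    using 0 by simp
  also have "\<dots> = (\<Sum>w\<in>X. f (word_delta w) * word_delta w u)"
    by (simp add: sum_fun_apply sum.reindex[OF inj_word_delta])
  also have "\<dots> = f (word_delta u)"
    using u(1) assms by (simp add: word_delta_def sum.delta' if_distrib cong: if_cong)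
  finally show "f x = 0" using u by simp
qed (use assms in simp)

text \<open>The basis is merely chosen; its cardinality comes out of the count in
  \<open>card_kernel_basis\<close>.\<close>

definition kernel_basis :: "real \<Rightarrow> nat set \<Rightarrow> (nat list \<Rightarrow> real) set" where
  "kernel_basis q B =
     (SOME K. K \<subseteq> del_kernel q B \<and> arr.independent K \<and> del_kernel q B \<subseteq> arr.span K)"

lemma kernel_basis:
  "kernel_basis q B \<subseteq> del_kernel q B" "arr.independent (kernel_basis q B)"
  "del_kernel q B \<subseteq> arr.span (kernel_basis q B)"
proof -
  have "\<exists>K. K \<subseteq> del_kernel q B \<and> arr.independent K \<and> del_kernel q B \<subseteq> arr.span K"
    using arr.maximal_independent_subset by metis
  from someI_ex[OF this]
  show "kernel_basis q B \<subseteq> del_kernel q B" "arr.independent (kernel_basis q B)"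
    "del_kernel q B \<subseteq> arr.span (kernel_basis q B)"
    by (auto simp: kernel_basis_def)
qed

lemma finite_kernel_basis:
  assumes "finite B"
  shows "finite (kernel_basis q B)"
proof -
  have sub: "kernel_basis q B \<subseteq> arr.span (word_delta ` permutations_of_set B)"
    using kernel_basis(1)[of q B] arr_space_span[OF assms] by (auto simp: del_kernel_def)
  show ?thesis
    using arr.independent_span_bound[OF _ kernel_basis(2) sub] assms by simp
qed

text \<open>Indexing by pairs keeps \<open>S\<close> visible, from which the eigenvalue of a basis
  vector is read off; the cardinality then splits as a sum over \<open>S\<close>.\<close>

definition eigen_index :: "real \<Rightarrow> nat set \<Rightarrow> (nat set \<times> (nat list \<Rightarrow> real)) set" where
  "eigen_index q A = (SIGMA S : Pow A. kernel_basis q (A - S))"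

lemma finite_eigen_index:
  assumes "finite A"
  shows "finite (eigen_index q A)"
  using assms by (auto simp: eigen_index_def intro!: finite_kernel_basis)

context
  fixes q :: real and A :: "nat set" and y :: "nat \<Rightarrow> real"
  assumes finA: "finite A" and q1: "q \<ge> 1" and ypos: "\<And>a. a \<in> A \<Longrightarrow> y a > 0"
begin

text \<open>Collecting the coefficients with the same \<open>S\<close> into one kernel element
  \<open>u S\<close> gives a vanishing sum of juxtapositions. Uniqueness forces \<open>u S\<close>
  to be zero, and then independence of the kernel basis applies.\<close>

lemma eigenvec_family_independent:
  assumes "\<And>w. (\<Sum>(S, g)\<in>eigen_index q A. c (S, g) * eigenvec q y S g w) = 0"
    and "(S, g) \<in> eigen_index q A"
  shows "c (S, g) = 0"
proof -
  define u where "u S w = (\<Sum>g\<in>kernel_basis q (A - S). c (S, g) * g w)" for S w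
  have uS: "u S = (\<Sum>g\<in>kernel_basis q (A - S). (\<lambda>w. c (S, g) * g w))" for S
    by (simp add: u_def fun_eq_iff sum_fun_apply)
  have "u T \<in> del_kernel q (A - T)" for T
    unfolding uS using kernel_basis(1)
    by (intro arr.subspace_sum arr.subspace_scale arr_subspace_del_kernel) auto
  moreover have "(\<Sum>S\<in>Pow A. eigenvec q y S (u S) w) = 0" for w
    using assms(1)[of w] finA unfolding eigen_index_def
    by (subst (asm) sum.Sigma[symmetric])
      (auto simp: u_def[abs_def] eigenvec_sum intro: finite_kernel_basis)
  ultimately have "u S = (\<lambda>w. 0)"
    using assms(2) by (intro eigenvec_sum_unique[OF finA q1 ypos]) (auto simp: eigen_index_def)
  then have "(\<Sum>g\<in>kernel_basis q (A - S). (\<lambda>w. c (S, g) * g w)) = 0"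
    unfolding uS[symmetric] by (simp add: zero_fun_def)
  then show ?thesis
    using assms(2) finA
    by (intro arr.independentD[OF kernel_basis(2) finite_kernel_basis[of "A - S" q] subset_refl])
      (auto simp: eigen_index_def)
qed

text \<open>A coincidence of two members of the family would be a linear relation with coefficients
  1 and -1, against independence in indexed form.\<close>

lemma inj_on_eigenvec: "inj_on (\<lambda>(S, g). eigenvec q y S g) (eigen_index q A)"
proof (rule inj_onI, rule ccontr)
  fix p r
  assume pr: "p \<in> eigen_index q A" "r \<in> eigen_index q A"
    "(case p of (S, g) \<Rightarrow> eigenvec q y S g) = (case r of (S, g) \<Rightarrow> eigenvec q y S g)" "p \<noteq> r"
  obtain S g T h where "p = (S, g)" "r = (T, h)" by (metis surj_pair)
  with pr have i: "(S, g) \<in> eigen_index q A" "(T, h) \<in> eigen_index q A"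
    and eq: "eigenvec q y S g = eigenvec q y T h" and ne: "\<not> (S = T \<and> g = h)"
    by auto
  define c where "c = (\<lambda>p. if p = (S, g) then 1 else if p = (T, h) then - 1 else (0::real))"
  have "(\<Sum>(U, k)\<in>eigen_index q A. c (U, k) * eigenvec q y U k w) = 0" for w
  proof -
    have "(\<Sum>(U, k)\<in>eigen_index q A. c (U, k) * eigenvec q y U k w) =
        (\<Sum>(U, k)\<in>{(S, g), (T, h)}. c (U, k) * eigenvec q y U k w)"
    proof (rule sum.mono_neutral_right)
      show "\<forall>p\<in>eigen_index q A - {(S, g), (T, h)}. (case p of (U, k) \<Rightarrow> c (U, k) * eigenvec q y U k w) = 0"
      proof
        fix p assume "p \<in> eigen_index q A - {(S, g), (T, h)}"
        then have "c p = 0" by (simp add: c_def)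
        then show "(case p of (U, k) \<Rightarrow> c (U, k) * eigenvec q y U k w) = 0" by (cases p) simp
      qed
    qed (use i finite_eigen_index[OF finA] in auto)
    also have "\<dots> = 0"
    proof -
      have nin: "(S, g) \<notin> {(T, h)}" and c: "c (S, g) = 1" "c (T, h) = - 1"
        using ne by (auto simp: c_def)
      show ?thesis
        unfolding sum.insert[OF finite.insertI[OF finite.emptyI] nin] by (simp add: c eq)
    qed
    finally show ?thesis .
  qed
  from eigenvec_family_independent[OF this i(1)] show False by (simp add: c_def)
qed

text \<open>The juxtapositions and the single words are two bases of \<open>arr_space A\<close>, so
  they are equally many.\<close>

lemma card_eigen_index: "card (eigen_index q A) = fact (card A)"
proof -
  let ?E = "(\<lambda>(S, g). eigenvec q y S g) ` eigen_index q A"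
  have ind: "arr.independent ?E"
  proof (rule arr.independent_if_scalars_zero)
    show "finite ?E" using finite_eigen_index[OF finA] by simp
  next
    fix f x
    assume 0: "(\<Sum>x\<in>?E. (\<lambda>w. f x * x w)) = 0" and "x \<in> ?E"
    then obtain S g where Sg: "(S, g) \<in> eigen_index q A" "x = eigenvec q y S g" by auto
    have "(\<Sum>(S, g)\<in>eigen_index q A. f (eigenvec q y S g) * eigenvec q y S g w) = 0" for w
      using fun_cong[OF 0, of w] unfolding sum_fun_apply sum.reindex[OF inj_on_eigenvec]
      by (simp add: case_prod_unfold)
    then show "f x = 0"
      using eigenvec_family_independent[of "\<lambda>(S, g). f (eigenvec q y S g)" S g] Sg by simp
  qed
  have "arr.span ?E = arr_space A"
  proof
    show "arr.span ?E \<subseteq> arr_space A"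
      by (rule arr.span_minimal[OF _ arr_subspace_arr_space])
        (use kernel_basis(1) in \<open>fastforce simp: eigen_index_def del_kernel_def
           intro!: eigenvec_arr_space[OF finA]\<close>)
    show "arr_space A \<subseteq> arr.span ?E"
    proof
      fix v assume v: "v \<in> arr_space A"
      have "\<exists>u. (\<forall>S. S \<subseteq> A \<longrightarrow> u S \<in> del_kernel q (A - S)) \<and>
          v = (\<lambda>w. \<Sum>S\<in>Pow A. eigenvec q y S (u S) w)"
      \<comment> \<open>No subset of \<open>A\<close> has \<open>card A + 1\<close> elements, so
        this choice of \<open>k\<close> makes the vanishing hypothesis vacuous.\<close>
      proof (rule eigenvec_sum_exists[OF finA q1 ypos v])
        fix S assume "S \<subseteq> A" "card S = Suc (card A)"
        then show "dels q (desc S) v = (\<lambda>w. 0)" using card_mono[OF finA, of S] by simp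
      qed
      then obtain u where u: "\<And>S. S \<subseteq> A \<Longrightarrow> u S \<in> del_kernel q (A - S)"
        "v = (\<lambda>w. \<Sum>S\<in>Pow A. eigenvec q y S (u S) w)"
        by blast
      have "eigenvec q y S (u S) \<in> arr.span ?E" if S: "S \<in> Pow A" for S
      proof -
        have "u S \<in> arr.span (kernel_basis q (A - S))"
          using u(1)[of S] S kernel_basis(3) by blast
        then obtain c where "u S = (\<Sum>g\<in>kernel_basis q (A - S). (\<lambda>w. c g * g w))"
          using finA by (auto simp: arr.span_finite finite_kernel_basis)
        then have uS: "u S = (\<lambda>w. \<Sum>g\<in>kernel_basis q (A - S). c g * g w)"
          by (simp add: fun_eq_iff sum_fun_apply)
        have "eigenvec q y S (u S) =
            (\<Sum>g\<in>kernel_basis q (A - S). (\<lambda>w. c g * eigenvec q y S g w))"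
          unfolding uS by (simp add: fun_eq_iff sum_fun_apply eigenvec_sum)
        also have "\<dots> \<in> arr.span ?E"
          using S by (intro arr.span_sum arr.span_scale arr.span_base) (auto simp: eigen_index_def)
        finally show ?thesis .
      qed
      then have "(\<Sum>S\<in>Pow A. eigenvec q y S (u S)) \<in> arr.span ?E"
        by (intro arr.span_sum)
      moreover have "(\<Sum>S\<in>Pow A. eigenvec q y S (u S)) = v"
        unfolding u(2) by (simp add: fun_eq_iff sum_fun_apply)
      ultimately show "v \<in> arr.span ?E" by simp
    qed
  qed
  then have "card ?E = card (word_delta ` permutations_of_set A)"
    using arr.dim_span_eq_card_independent[OF ind]
      arr.dim_span_eq_card_independent[OF independent_word_delta[of "permutations_of_set A"]]
      arr_space_span[OF finA] finA by simp
  then show ?thesis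
    using finA by (simp add: card_image inj_on_eigenvec inj_word_delta)
qed

end

text \<open>The kernels do not involve the weights, so the count may be made with all weights equal
  to 1.\<close>

lemma sum_card_kernel_basis:
  assumes "finite A" "q \<ge> 1"
  shows "(\<Sum>S\<in>Pow A. card (kernel_basis q (A - S))) = fact (card A)"
  using card_eigen_index[OF assms, of "\<lambda>_. 1"] assms
  by (simp add: eigen_index_def card_SigmaI finite_kernel_basis)

section \<open>Derangement numbers as kernel dimensions\<close>

lemma card_derangements:
  assumes "finite T"
  shows "card {\<pi>. \<pi> permutes T \<and> (\<forall>i\<in>T. \<pi> i \<noteq> i)} = derangement_number (card T)"
proof -
  obtain h where h: "bij_betw h T {1..card T}"
    using assms by (metis finite_same_card_bij finite_atLeastAtMost card_atLeastAtMost diff_Suc_1)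
  let ?f = "\<lambda>\<pi> x. if x \<in> {1..card T} then h (\<pi> (inv_into T h x)) else x"
  have bij: "bij_betw ?f {\<pi>. \<pi> permutes T} {\<pi>. \<pi> permutes {1..card T}}"
    by (rule bij_betw_permutations[OF h])
  have iff: "(\<forall>i\<in>{1..card T}. ?f \<pi> i \<noteq> i) \<longleftrightarrow> (\<forall>i\<in>T. \<pi> i \<noteq> i)" if "\<pi> permutes T" for \<pi>
  proof -
    have im: "{1..card T} = h ` T" "inj_on h T"
      using h by (simp_all add: bij_betw_def)
    have "(\<forall>i\<in>{1..card T}. ?f \<pi> i \<noteq> i) \<longleftrightarrow> (\<forall>i\<in>T. h (\<pi> i) \<noteq> h i)"
      unfolding im(1) using im(2) by simp
    also have "\<dots> \<longleftrightarrow> (\<forall>i\<in>T. \<pi> i \<noteq> i)"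
      using h that permutes_in_image[OF that] by (auto simp: bij_betw_def inj_on_eq_iff)
    finally show ?thesis .
  qed
  have "bij_betw ?f {\<pi> \<in> {\<pi>. \<pi> permutes T}. \<forall>i\<in>T. \<pi> i \<noteq> i}
      {\<pi> \<in> {\<pi>. \<pi> permutes {1..card T}}. \<forall>i\<in>{1..card T}. \<pi> i \<noteq> i}"
    by (rule bij_betw_Collect[OF bij]) (use iff in auto)
  then show ?thesis
    unfolding derangement_number_def using bij_betw_same_card by force
qed

text \<open>Permutations of \<open>A\<close> are sorted by the set \<open>T\<close> of points that
  they move; each restricts to a derangement of its \<open>T\<close>.\<close>

lemma sum_derangement_number:
  assumes "finite A"
  shows "(\<Sum>T\<in>Pow A. derangement_number (card T)) = fact (card A)"
proof -
  let ?D = "\<lambda>T. {\<pi>. \<pi> permutes T \<and> (\<forall>i\<in>T. \<pi> i \<noteq> i)}"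
  have "{\<pi>. \<pi> permutes A} = (\<Union>T\<in>Pow A. ?D T)"
  proof (intro equalityI subsetI)
    fix \<pi> assume "\<pi> \<in> {\<pi>. \<pi> permutes A}"
    then have p: "\<pi> permutes A" by simp
    have "\<pi> permutes {i \<in> A. \<pi> i \<noteq> i}"
      by (rule permutes_superset[OF p]) auto
    then show "\<pi> \<in> (\<Union>T\<in>Pow A. ?D T)"
      by (intro UN_I[of "{i \<in> A. \<pi> i \<noteq> i}"]) simp_all
  next
    fix \<pi> assume "\<pi> \<in> (\<Union>T\<in>Pow A. ?D T)"
    then show "\<pi> \<in> {\<pi>. \<pi> permutes A}" using permutes_subset by auto
  qed
  moreover have "card (\<Union>T\<in>Pow A. ?D T) = (\<Sum>T\<in>Pow A. card (?D T))"
  proof (rule card_UN_disjoint)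
    show "finite (Pow A)" using assms by simp
    show "\<forall>T\<in>Pow A. finite (?D T)"
    proof
      fix T assume "T \<in> Pow A"
      then have "finite T" using assms finite_subset by blast
      then show "finite (?D T)" using finite_permutations[of T] by simp
    qed
    have "T = {i. \<pi> i \<noteq> i}" if "\<pi> permutes T" "\<forall>i\<in>T. \<pi> i \<noteq> i" for \<pi> T
      using that permutes_not_in[OF that(1)] by fast
    then show "\<forall>T\<in>Pow A. \<forall>U\<in>Pow A. T \<noteq> U \<longrightarrow> ?D T \<inter> ?D U = {}" by fast
  qed
  ultimately have "fact (card A) = (\<Sum>T\<in>Pow A. card (?D T))"
    using card_permutations[OF refl assms] by simp
  also have "\<dots> = (\<Sum>T\<in>Pow A. derangement_number (card T))"
    using assms by (intro sum.cong refl card_derangements) (auto intro: finite_subset)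
  finally show ?thesis ..
qed

text \<open>Kernel dimensions and derangement numbers have the same sums over all subsets of a
  finite set, namely a factorial. By induction on proper subsets all terms but that of
  \<open>A\<close> agree, hence so does this one.\<close>

lemma card_kernel_basis:
  assumes "finite A" "q \<ge> 1"
  shows "card (kernel_basis q A) = derangement_number (card A)"
  using assms(1)
proof (induction A rule: finite_psubset_induct)
  case (psubset A)
  have re: "(\<Sum>S\<in>Pow A. f (A - S)) = f A + (\<Sum>T\<in>Pow A - {A}. f T)" for f :: "nat set \<Rightarrow> nat"
  proof -
    have "(\<Sum>S\<in>Pow A. f (A - S)) = (\<Sum>T\<in>Pow A. f T)"
      by (rule sum.reindex_bij_witness[of _ "\<lambda>T. A - T" "\<lambda>T. A - T"]) auto
    then show ?thesis
      using psubset.hyps by (simp add: sum.remove[of "Pow A" A])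
  qed
  have "(\<Sum>S\<in>Pow A. derangement_number (card (A - S))) = (\<Sum>T\<in>Pow A. derangement_number (card T))"
    by (rule sum.reindex_bij_witness[of _ "\<lambda>T. A - T" "\<lambda>T. A - T"]) auto
  then have "(\<Sum>S\<in>Pow A. card (kernel_basis q (A - S))) =
      (\<Sum>S\<in>Pow A. derangement_number (card (A - S)))"
    using sum_card_kernel_basis[OF psubset.hyps assms(2)] sum_derangement_number[OF psubset.hyps]
    by simp
  moreover have "(\<Sum>T\<in>Pow A - {A}. card (kernel_basis q T)) =
      (\<Sum>T\<in>Pow A - {A}. derangement_number (card T))"
    by (intro sum.cong refl psubset.IH) auto
  ultimately show ?case
    unfolding re[of "\<lambda>T. card (kernel_basis q T)"] re[of "\<lambda>T. derangement_number (card T)"] by simp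
qed

section \<open>The Hecke action on words\<close>

definition adj_swap :: "nat \<Rightarrow> nat list \<Rightarrow> nat list" where
  "adj_swap j w = w[j := w ! Suc j, Suc j := w ! j]"

text \<open>This collects what the word \<open>w\<close> receives: a descent in \<open>w\<close> is
  an ascent of the swapped word, so the test is the reverse of that in \<open>hecke_T\<close>, which
  speaks of the source. Positions count from 0, so \<open>j\<close> stands for the generator with
  index \<open>j + 1\<close>.\<close>

definition hecke_list :: "real \<Rightarrow> nat \<Rightarrow> (nat list \<Rightarrow> real) \<Rightarrow> nat list \<Rightarrow> real" where
  "hecke_list q j v w = (if w ! Suc j < w ! j then v (adj_swap j w)
     else q * v (adj_swap j w) + (q - 1) * v w)"

fun hecke_list_desc :: "real \<Rightarrow> nat \<Rightarrow> (nat list \<Rightarrow> real) \<Rightarrow> nat list \<Rightarrow> real" where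
  "hecke_list_desc q 0 v = v"
| "hecke_list_desc q (Suc m) v = hecke_list_desc q m (hecke_list q m v)"

text \<open>
  In \<open>hecke_list_desc\<close> the operator at position \<open>0\<close> acts last, so expanding it first gives a
  recursion along the word.
\<close>

lemma hecke_list_desc_Cons:
  assumes "a \<noteq> b"
  shows "hecke_list_desc q (Suc m) v (a # b # w) =
    (if a < b then q * hecke_list_desc q m (\<lambda>u. v (b # u)) (a # w) +
         (q - 1) * hecke_list_desc q m (\<lambda>u. v (a # u)) (b # w)
     else hecke_list_desc q m (\<lambda>u. v (b # u)) (a # w))"
proof (induction m arbitrary: v)
  case 0
  then show ?case using assms by (auto simp: hecke_list_def adj_swap_def)
next
  case (Suc m)
  \<comment> \<open>Fixing the first letter lowers all later positions by one.\<close>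
  have "(\<lambda>u. hecke_list q (Suc m) v (c # u)) = hecke_list q m (\<lambda>u. v (c # u))" for c
    by (simp add: hecke_list_def adj_swap_def fun_eq_iff)
  then show ?case
    using Suc[of "hecke_list q (Suc m) v"] by simp
qed

text \<open>Apart from \<open>m = 0\<close>, every summand ends with the operator at position 0,
  whose expansion in \<open>hecke_list_desc_Cons\<close> leads to the same sums for a word shorter
  by one letter; this is the recursion of \<open>del\<close>.\<close>

lemma sum_hecke_list_desc:
  assumes "distinct (a # w)"
  shows "(\<Sum>m\<le>length w. hecke_list_desc q m v (a # w)) = del q a v w"
  using assms
proof (induction w arbitrary: a v)
  case (Cons b w)
  have ab: "a \<noteq> b" and d: "distinct (a # w)" "distinct (b # w)" using Cons.prems by auto
  have "(\<Sum>m\<le>length (b # w). hecke_list_desc q m v (a # b # w)) =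
      v (a # b # w) + (\<Sum>m\<le>length w. hecke_list_desc q (Suc m) v (a # b # w))"
    by (simp add: sum.atMost_Suc_shift del: hecke_list_desc.simps(2) sum.atMost_Suc)
  also have "\<dots> = del q a v (b # w)"
    unfolding hecke_list_desc_Cons[OF ab] using Cons.IH[OF d(1)] Cons.IH[OF d(2)]
    by (simp add: sum.distrib flip: sum_distrib_left)
  finally show ?case .
qed simp

section \<open>From permutations to words\<close>

definition word_of :: "nat \<Rightarrow> (nat \<Rightarrow> nat) \<Rightarrow> nat list" where
  "word_of n \<sigma> = map \<sigma> [1..<Suc n]"

lemma bij_betw_word_of: "bij_betw (word_of n) (sym_perms n) (permutations_of_set {1..n})"
proof -
  have inj: "inj_on (word_of n) (sym_perms n)"
  proof (rule inj_onI)
    fix \<sigma> \<tau> assume a: "\<sigma> \<in> sym_perms n" "\<tau> \<in> sym_perms n" "word_of n \<sigma> = word_of n \<tau>"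
    have "\<sigma> i = \<tau> i" if "i \<in> {1..n}" for i
      using a(3) that by (simp add: word_of_def del: upt_Suc)
    moreover have "\<sigma> i = \<tau> i" if "i \<notin> {1..n}" for i
      using a(1,2) that permutes_not_in[of _ "{1..n}" i] unfolding sym_perms_def mem_Collect_eq
      by metis
    ultimately show "\<sigma> = \<tau>" by blast
  qed
  have "word_of n ` sym_perms n \<subseteq> permutations_of_set {1..n}"
  proof
    fix w assume "w \<in> word_of n ` sym_perms n"
    then obtain \<sigma> where s: "\<sigma> permutes {1..n}" "w = word_of n \<sigma>" by (auto simp: sym_perms_def)
    have *: "set [1..<Suc n] = {1..n}" by auto
    have "set w = {1..n}"
      unfolding s(2) word_of_def set_map * using permutes_image[OF s(1)] .
    moreover have "distinct w"
      using permutes_inj_on[OF s(1)] by (simp add: s(2) word_of_def distinct_map)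
    ultimately show "w \<in> permutations_of_set {1..n}" by (simp add: permutations_of_set_def)
  qed
  moreover have "card (word_of n ` sym_perms n) = card (permutations_of_set {1..n})"
    using card_image[OF inj] card_permutations[of "{1..n}" n] by (simp add: sym_perms_def)
  ultimately have "word_of n ` sym_perms n = permutations_of_set {1..n}"
    by (intro card_subset_eq) auto
  then show ?thesis
    using inj by (simp add: bij_betw_def)
qed

lemma finite_sym_perms: "finite (sym_perms n)"
  unfolding sym_perms_def by (rule finite_permutations) simp

lemma hecke_T_word_of:
  assumes "Suc j < n" "\<sigma> \<in> sym_perms n"
    and v: "\<And>\<pi>. \<pi> \<in> sym_perms n \<Longrightarrow> v (word_of n \<pi>) = u \<pi>"
  shows "hecke_T n q (Suc j) u \<sigma> = hecke_list q j v (word_of n \<sigma>)"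
proof -
  let ?t = "transpose (Suc j) (Suc j + 1)"
  let ?\<tau> = "\<sigma> \<circ> ?t"
  have \<sigma>: "\<sigma> permutes {1..n}" using assms(2) by (simp add: sym_perms_def)
  have ne: "\<sigma> (Suc j) \<noteq> \<sigma> (Suc (Suc j))"
    using permutes_inj[OF \<sigma>] by (simp add: inj_eq)
  have \<tau>: "?\<tau> \<in> sym_perms n"
    unfolding sym_perms_def mem_Collect_eq
    by (rule permutes_compose[OF permutes_swap_id \<sigma>]) (use assms(1) in auto)
  have \<tau>val: "?\<tau> (Suc j) = \<sigma> (Suc j + 1)" "?\<tau> (Suc j + 1) = \<sigma> (Suc j)"
    by simp_all
  have ne': "?\<tau> \<noteq> \<sigma>" using ne \<tau>val(1) by (metis Suc_eq_plus1)
  have eq: "\<sigma> = \<pi> \<circ> ?t \<longleftrightarrow> \<pi> = ?\<tau>" for \<pi>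
    by (auto simp: fun_eq_iff comp_def)
  \<comment> \<open>\<open>cs\<close> and \<open>ct\<close> are the coefficients that
    \<open>\<sigma>\<close> receives from itself and from \<open>?\<tau>\<close>, the only two
    permutations whose images can involve it.\<close>
  define cs where "cs = (if \<sigma> (Suc j + 1) < \<sigma> (Suc j) then 0 else q - 1)"
  define ct where "ct = (if \<sigma> (Suc j + 1) < \<sigma> (Suc j) then 1 else q)"
  have "hecke_T n q (Suc j) u \<sigma> = (\<Sum>\<pi>\<in>sym_perms n.
      (if \<pi> = \<sigma> then u \<sigma> * cs else 0) + (if \<pi> = ?\<tau> then u ?\<tau> * ct else 0))"
    unfolding hecke_T_def lin_ext_def
  proof (intro sum.cong refl)
    fix \<pi>
    have b: "basis_vec (\<pi> \<circ> ?t) \<sigma> = (if \<pi> = ?\<tau> then 1 else 0)"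
      "basis_vec \<pi> \<sigma> = (if \<pi> = \<sigma> then 1 else 0)"
      unfolding basis_vec_def by (simp_all only: eq eq_commute[of \<sigma> \<pi>])
    consider "\<pi> = \<sigma>" | "\<pi> = ?\<tau>" | "\<pi> \<noteq> \<sigma>" "\<pi> \<noteq> ?\<tau>" by blast
    then show "u \<pi> * (if \<pi> (Suc j + 1) < \<pi> (Suc j) then q * basis_vec (\<pi> \<circ> ?t) \<sigma>
        else basis_vec (\<pi> \<circ> ?t) \<sigma> + (q - 1) * basis_vec \<pi> \<sigma>) =
      (if \<pi> = \<sigma> then u \<sigma> * cs else 0) + (if \<pi> = ?\<tau> then u ?\<tau> * ct else 0)"
    proof cases
      case 1
      then show ?thesis unfolding b using ne' by (simp add: cs_def)
    next
      case 2
      then show ?thesis using ne' ne unfolding b unfolding 2 \<tau>val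
        by (auto simp: ct_def)
    next
      case 3
      then show ?thesis unfolding b by simp
    qed
  qed
  also have "\<dots> = u \<sigma> * cs + u ?\<tau> * ct"
    using assms(2) \<tau> finite_sym_perms by (simp add: sum.distrib)
  also have "\<dots> = hecke_list q j v (word_of n \<sigma>)"
  proof -
    have nth: "word_of n \<pi> ! k = \<pi> (Suc k)" if "k < n" for \<pi> k
      using that by (simp add: word_of_def del: upt_Suc)
    have "word_of n ?\<tau> = adj_swap j (word_of n \<sigma>)"
    proof (rule nth_equalityI)
      fix k assume "k < length (word_of n ?\<tau>)"
      then have k: "k < n" by (simp add: word_of_def del: upt_Suc)
      have len: "length (word_of n \<sigma>) = n" by (simp add: word_of_def)
      show "word_of n ?\<tau> ! k = adj_swap j (word_of n \<sigma>) ! k"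
        using k assms(1) len
        by (auto simp: nth adj_swap_def nth_list_update transpose_def)
    qed (simp add: word_of_def adj_swap_def)
    then show ?thesis
      unfolding hecke_list_def using assms(1) v[OF assms(2)] v[OF \<tau>]
      by (simp add: nth cs_def ct_def)
  qed
  finally show ?thesis .
qed

lemma hecke_desc_word_of:
  assumes "m < n" "\<sigma> \<in> sym_perms n"
    and "\<And>\<pi>. \<pi> \<in> sym_perms n \<Longrightarrow> v (word_of n \<pi>) = u \<pi>"
  shows "hecke_desc n q m u \<sigma> = hecke_list_desc q m v (word_of n \<sigma>)"
  using assms
proof (induction m arbitrary: u v)
  case (Suc m)
  show ?case
    using Suc.prems by (auto intro!: Suc.IH hecke_T_word_of[symmetric])
qed simp

text \<open>\<open>weight_X\<close> is diagonal and sees only the first letter, so it factors out;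
  summing the Hecke products over \<open>i - 1 = 0, ..., n - 1\<close> gives the deletion of that
  letter.\<close>

lemma q_tsetlin_word_of:
  assumes "n \<ge> 1" "\<sigma> \<in> sym_perms n"
    and v: "\<And>\<pi>. \<pi> \<in> sym_perms n \<Longrightarrow> v (word_of n \<pi>) = u \<pi>"
  shows "q_tsetlin n q x u \<sigma> = lib_op q (\<lambda>i. x i / q ^ (n - i)) v (word_of n \<sigma>)"
proof -
  have w: "weight_X n q x z \<sigma> = x (\<sigma> 1) / q ^ (n - \<sigma> 1) * z \<sigma>" for z
    using assms(2) finite_sym_perms
    by (simp add: weight_X_def lin_ext_def basis_vec_def if_distrib cong: if_cong)
  define r where "r = map \<sigma> [2..<Suc n]"
  have word: "word_of n \<sigma> = \<sigma> 1 # r"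
    using assms(1) by (simp add: word_of_def r_def upt_conv_Cons numeral_2_eq_2 del: upt_Suc)
  have len: "length r = n - 1" by (simp add: r_def del: upt_Suc)
  have "distinct (word_of n \<sigma>)"
    using bij_betw_word_of assms(2) by (metis bij_betwE permutations_of_setD(2))
  then have d: "distinct (\<sigma> 1 # r)" by (simp add: word)
  have "q_tsetlin n q x u \<sigma> =
      x (\<sigma> 1) / q ^ (n - \<sigma> 1) * (\<Sum>i=1..n. hecke_desc n q (i - 1) u \<sigma>)"
    unfolding q_tsetlin_def w by (simp add: sum_distrib_left)
  also have "(\<Sum>i=1..n. hecke_desc n q (i - 1) u \<sigma>) = (\<Sum>m\<le>length r. hecke_desc n q m u \<sigma>)"
    by (rule sum.reindex_bij_witness[of _ Suc "\<lambda>i. i - 1"]) (use assms(1) len in auto)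
  also have "\<dots> = (\<Sum>m\<le>length r. hecke_list_desc q m v (\<sigma> 1 # r))"
    by (intro sum.cong refl, subst word[symmetric], rule hecke_desc_word_of)
      (use assms len in auto)
  also have "\<dots> = del q (\<sigma> 1) v r"
    by (rule sum_hecke_list_desc[OF d])
  finally show ?thesis by (simp add: lib_op_def word)
qed

text \<open>Exactly \<open>j - 1\<close> elements of \<open>S\<close> exceed the \<open>j\<close>-th
  largest one, so the power of \<open>q\<close> in \<open>top_eigenvalue\<close> accounts for the
  shift of the exponent by \<open>j - 1\<close>.\<close>

lemma tsetlin_eigenvalue_eq:
  assumes "q > 0" "S \<subseteq> {1..n}"
  shows "tsetlin_eigenvalue n q x S = top_eigenvalue q (\<lambda>i. x i / q ^ (n - i)) S"
proof -
  have fin: "finite S" using assms(2) finite_subset by blast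
  let ?d = "desc_elem S"
  have len: "length (desc S) = card S" using fin by (simp add: desc_set)
  have d: "?d (Suc k) = desc S ! k" for k by (simp add: desc_elem_def desc_def)
  have sorted: "desc S ! k > desc S ! l" if "k < l" "l < card S" for k l
  proof -
    have "sorted_wrt (>) (desc S)"
      using strict_sorted_list_of_set[of S] by (simp add: desc_def sorted_wrt_rev)
    from sorted_wrt_nth_less[OF this that(1)] show ?thesis using that len by simp
  qed
  have above: "num_above S (desc S ! k) = k" if k: "k < card S" for k
  proof -
    have "{b \<in> S. desc S ! k < b} = (\<lambda>l. desc S ! l) ` {..<k}"
    proof (intro equalityI subsetI)
      fix b assume b: "b \<in> {b \<in> S. desc S ! k < b}"
      then obtain l where l: "l < card S" "b = desc S ! l"
        using desc_set(2)[OF fin] len by (metis (no_types, lifting) in_set_conv_nth mem_Collect_eq)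
      then have "l < k" using b k sorted[of k l] by (metis (mono_tags, lifting) linorder_neqE_nat mem_Collect_eq order_less_asym)
      then show "b \<in> (\<lambda>l. desc S ! l) ` {..<k}" using l by blast
    next
      fix b assume "b \<in> (\<lambda>l. desc S ! l) ` {..<k}"
      then obtain l where "l < k" "b = desc S ! l" by blast
      then show "b \<in> {b \<in> S. desc S ! k < b}"
        using sorted[of l k] k desc_set(2)[OF fin] len nth_mem[of l "desc S"] by simp
    qed
    moreover have "inj_on (\<lambda>l. desc S ! l) {..<k}"
      using desc_set(1)[OF fin] k len by (auto simp: inj_on_def nth_eq_iff_index_eq)
    ultimately show ?thesis by (simp add: num_above_def card_image)
  qed
  have bij: "bij_betw (\<lambda>k. desc S ! k) {..<card S} S"
    using bij_betw_nth[OF desc_set(1)[OF fin]] len desc_set(2)[OF fin] by auto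
  have "tsetlin_eigenvalue n q x S =
      (\<Sum>k<card S. x (desc S ! k) / q ^ (n + 1 - desc S ! k - Suc k))"
    unfolding tsetlin_eigenvalue_def
    by (rule sum.reindex_bij_witness[of _ Suc "\<lambda>j. j - 1"]) (auto simp: d[symmetric])
  also have "\<dots> = (\<Sum>k<card S. x (desc S ! k) / q ^ (n - desc S ! k) * q ^ num_above S (desc S ! k))"
  proof (rule sum.cong)
    fix k assume "k \<in> {..<card S}"
    then have k: "k < card S" by simp
    \<comment> \<open>The \<open>k\<close> larger elements of \<open>S\<close> are at most
      \<open>n\<close>, so the exponent \<open>n + 1 - desc S ! k - Suc k\<close> is not
      truncated.\<close>
    have "{b \<in> S. desc S ! k < b} \<subseteq> {desc S ! k<..n}" using assms(2) by auto
    from card_mono[OF _ this] have "k \<le> n - desc S ! k"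
      using above[OF k] by (simp add: num_above_def)
    then have "n - desc S ! k = (n + 1 - desc S ! k - Suc k) + k" by linarith
    then have "q ^ (n - desc S ! k) = q ^ (n + 1 - desc S ! k - Suc k) * q ^ k"
      by (metis power_add)
    then show "x (desc S ! k) / q ^ (n + 1 - desc S ! k - Suc k) =
        x (desc S ! k) / q ^ (n - desc S ! k) * q ^ num_above S (desc S ! k)"
      using assms(1) above[OF k] by simp
  qed simp
  also have "\<dots> = top_eigenvalue q (\<lambda>i. x i / q ^ (n - i)) S"
    unfolding top_eigenvalue_def by (rule sum.reindex_bij_betw[OF bij])
  finally show ?thesis .
qed

section \<open>The transition matrix\<close>

lemma lib_op_sum:
  "lib_op q y (\<lambda>u. \<Sum>i\<in>I. c i * f i u) w = (\<Sum>i\<in>I. c i * lib_op q y (f i) w)"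
  by (cases w) (simp_all add: lib_op_def del_sum del_cmult sum_distrib_left algebra_simps)

lemma order_prod:
  assumes "\<And>i. i \<in> I \<Longrightarrow> f i \<noteq> 0"
  shows "order c (\<Prod>i\<in>I. f i) = (\<Sum>i\<in>I. order c (f i :: real poly))"
  using assms
proof (induction I rule: infinite_finite_induct)
  case (insert i I)
  then have "(\<Prod>i\<in>I. f i) \<noteq> 0" by (simp add: prod_zero_iff)
  then show ?case using insert by (simp add: order_mult)
qed (simp_all add: order_0I)

theorem theorem2p7:
  fixes n :: nat and q :: real and x :: "nat \<Rightarrow> real" and e :: "nat \<Rightarrow> nat \<Rightarrow> nat"
  assumes "n \<ge> 1"
    and "q \<ge> 1"
    and "\<And>i. i \<in> {1..n} \<Longrightarrow> x i > 0"
    and "(\<Sum>i=1..n. x i) = 1"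
    and "bij_betw e {0..<fact n} (sym_perms n)"
  shows "char_poly (transition_matrix n q x e) =
           (\<Prod>S\<in>Pow {1..n}. [:- tsetlin_eigenvalue n q x S, 1:] ^ derangement_number (n - card S))
       \<and> {c. eigenvalue (transition_matrix n q x e) c} =
           {tsetlin_eigenvalue n q x S | S. S \<subseteq> {1..n} \<and> derangement_number (n - card S) \<noteq> 0}
       \<and> (\<forall>c. order c (char_poly (transition_matrix n q x e)) =
           (\<Sum>S | S \<subseteq> {1..n} \<and> tsetlin_eigenvalue n q x S = c. derangement_number (n - card S)))
       \<and> ((\<forall>S T. S \<subseteq> {1..n} \<longrightarrow> T \<subseteq> {1..n} \<longrightarrow>
             tsetlin_eigenvalue n q x T = tsetlin_eigenvalue n q x S \<longrightarrow> S = T)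
           \<longrightarrow> diagonalizable_mat (transition_matrix n q x e))"
proof -
  define N where "N = (fact n :: nat)"
  define M where "M = transition_matrix n q x e"
  define A where "A = {1..n}"
  define y where "y i = x i / q ^ (n - i)" for i
  define ev where "ev = tsetlin_eigenvalue n q x"
  have finA: "finite A" and cardA: "card A = n" by (simp_all add: A_def)
  have ypos: "y a > 0" if "a \<in> A" for a
    using that assms(2,3) by (simp add: y_def A_def)
  have ev: "ev S = top_eigenvalue q y S" if "S \<subseteq> A" for S
    using tsetlin_eigenvalue_eq[of q S n x] that assms(2)
    by (simp add: ev_def A_def y_def[abs_def])
  have M: "M \<in> carrier_mat N N" by (simp add: M_def N_def transition_matrix_def)

  have bijw: "bij_betw (\<lambda>a. word_of n (e a)) {0..<N} (permutations_of_set A)"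
    using bij_betw_trans[OF assms(5) bij_betw_word_of] by (simp add: comp_def N_def A_def)
  have Mab: "M $$ (a, b) = lib_op q y (word_delta (word_of n (e a))) (word_of n (e b))"
    if ab: "a < N" "b < N" for a b
  proof -
    have mem: "e a \<in> sym_perms n" "e b \<in> sym_perms n"
      using ab assms(5) by (auto simp: N_def bij_betw_def)
    have "word_delta (word_of n (e a)) (word_of n \<pi>) = basis_vec (e a) \<pi>"
      if "\<pi> \<in> sym_perms n" for \<pi>
      using that mem bij_betw_word_of[of n]
      by (auto simp: word_delta_def basis_vec_def bij_betw_def inj_on_eq_iff)
    then have "q_tsetlin n q x (basis_vec (e a)) (e b) =
        lib_op q y (word_delta (word_of n (e a))) (word_of n (e b))"
      unfolding y_def[abs_def] by (rule q_tsetlin_word_of[OF assms(1) mem(2)])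
    then show ?thesis
      using ab by (simp add: M_def transition_matrix_def N_def)
  qed

  obtain h where h: "bij_betw h {0..<N} (eigen_index q A)"
    using ex_bij_betw_nat_finite[OF finite_eigen_index[OF finA, of q]]
    card_eigen_index[OF finA assms(2) ypos] cardA by (auto simp: N_def)
  define vec where "vec k = (case h k of (S, g) \<Rightarrow> eigenvec q y S g)" for k
  \<comment> \<open>Operators act on the right, so eigenvectors are row vectors: row
    \<open>k\<close> of \<open>P\<close> lists the values of \<open>vec k\<close>, and the
    eigenvector equations become \<open>P * M = D * P\<close>.\<close>
  define P where "P = mat N N (\<lambda>(k, b). vec k (word_of n (e b)))"
  define D where "D = mat N N (\<lambda>(k, l). if k = l then ev (fst (h k)) else 0)"
  have P: "P \<in> carrier_mat N N" and D: "D \<in> carrier_mat N N" by (simp_all add: P_def D_def)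
  have hk: "fst (h k) \<subseteq> A" "snd (h k) \<in> del_kernel q (A - fst (h k))" if "k < N" for k
  proof -
    have "h k \<in> eigen_index q A" using h that by (auto simp: bij_betw_def)
    then show "fst (h k) \<subseteq> A" "snd (h k) \<in> del_kernel q (A - fst (h k))"
      using kernel_basis(1)[of q "A - fst (h k)"] by (auto simp: eigen_index_def)
  qed
  have vec_space: "vec k \<in> arr_space A" if "k < N" for k
    using eigenvec_arr_space[OF finA hk(1)[OF that]] hk(2)[OF that]
    by (auto simp: vec_def case_prod_unfold del_kernel_def)
  have vec_eigen: "lib_op q y (vec k) w = ev (fst (h k)) * vec k w" if "k < N" for k w
    unfolding vec_def case_prod_unfold eigenvec_def ev[OF hk(1)[OF that]]
    by (rule lib_op_eigenvector[OF _ assms(2) _ hk(2)[OF that]])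
      (use hk(1)[OF that] finA ypos in \<open>auto intro: finite_subset\<close>)

  have PM: "P * M = D * P"
  proof (rule eq_matI)
    fix k b assume "k < dim_row (D * P)" "b < dim_col (D * P)"
    then have kb: "k < N" "b < N" using P D by auto
    let ?w = "\<lambda>a. word_of n (e a)"
    have "(P * M) $$ (k, b) = (\<Sum>a = 0..<N. vec k (?w a) * lib_op q y (word_delta (?w a)) (?w b))"
      using kb M P Mab by (auto simp: scalar_prod_def P_def intro!: sum.cong)
    also have "\<dots> = lib_op q y (\<lambda>u. \<Sum>a = 0..<N. vec k (?w a) * word_delta (?w a) u) (?w b)"
      by (simp add: lib_op_sum)
    also have "(\<lambda>u. \<Sum>a = 0..<N. vec k (?w a) * word_delta (?w a) u) =
        (\<lambda>u. \<Sum>w\<in>permutations_of_set A. vec k w * word_delta w u)"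
      by (rule ext, rule sum.reindex_bij_betw[OF bijw])
    also have "\<dots> = vec k"
      by (rule arr_space_expand[OF finA vec_space[OF kb(1)], symmetric])
    also have "lib_op q y (vec k) (?w b) = ev (fst (h k)) * vec k (?w b)"
      by (rule vec_eigen[OF kb(1)])
    also have "\<dots> = (\<Sum>l = 0..<N. (if k = l then ev (fst (h k)) else 0) * vec l (?w b))"
      using kb by (simp add: if_distrib[of "\<lambda>z. z * _"] cong: if_cong)
    also have "\<dots> = (D * P) $$ (k, b)"
      using kb P D by (simp add: scalar_prod_def P_def D_def)
    finally show "(P * M) $$ (k, b) = (D * P) $$ (k, b)" .
  qed (use P D M in auto)

  \<comment> \<open>A null vector of the transpose is a linear relation among the rows. Off the
    arrangements of \<open>A\<close> all \<open>vec k\<close> vanish, so it is a relation between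
    functions on all lists, which \<open>eigenvec_family_independent\<close> excludes.\<close>
  have "det P \<noteq> 0"
  proof
    assume "det P = 0"
    then have "det (transpose_mat P) = 0" using det_transpose[OF P] by simp
    then obtain c where c: "c \<in> carrier_vec N" "c \<noteq> 0\<^sub>v N" "transpose_mat P *\<^sub>v c = 0\<^sub>v N"
      using det_0_iff_vec_prod_zero[of "transpose_mat P" N] P by auto
    have z: "(\<Sum>k = 0..<N. c $ k * vec k w) = 0" for w
    proof (cases "w \<in> permutations_of_set A")
      case True
      then have "w \<in> (\<lambda>a. word_of n (e a)) ` {0..<N}"
        using bij_betw_imp_surj_on[OF bijw] by simp
      then obtain b where b: "b < N" "w = word_of n (e b)"
        by auto
      have "0 = (transpose_mat P *\<^sub>v c) $ b" using c(3) b by simp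
      also have "\<dots> = (\<Sum>k = 0..<N. c $ k * vec k w)"
        using b P c(1) by (auto simp: scalar_prod_def P_def mult.commute intro!: sum.cong)
      finally show ?thesis by simp
    next
      case False
      then have "vec k w = 0" if "k < N" for k
        using vec_space[OF that] finA
        by (auto simp: arr_space_def permutations_of_set_def mset_eq_mset_set_iff)
      then show ?thesis by simp
    qed
    define d where "d p = c $ (inv_into {0..<N} h p)" for p
    have dh: "d (h k) = c $ k" if "k < N" for k
      using h that by (simp add: d_def bij_betw_def inv_into_f_f)
    have zero: "(\<Sum>(S, g)\<in>eigen_index q A. d (S, g) * eigenvec q y S g w) = 0" for w
    proof -
      have "(\<Sum>(S, g)\<in>eigen_index q A. d (S, g) * eigenvec q y S g w) =
          (\<Sum>k = 0..<N. d (h k) * vec k w)"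
        by (subst sum.reindex_bij_betw[OF h, symmetric]) (simp add: vec_def case_prod_unfold)
      also have "\<dots> = 0" using z[of w] dh by simp
      finally show ?thesis .
    qed
    have "c $ k = 0" if "k < N" for k
    proof -
      have "h k \<in> eigen_index q A" using h that by (auto simp: bij_betw_def)
      then show ?thesis
        using eigenvec_family_independent[OF finA assms(2) ypos zero, of "fst (h k)" "snd (h k)"]
          dh[OF that] by simp
    qed
    then have "c = 0\<^sub>v N" using c(1) by (intro eq_vecI) auto
    then show False using c(2) by simp
  qed
  then obtain Q where Q: "Q \<in> carrier_mat N N" "P * Q = 1\<^sub>m N" "Q * P = 1\<^sub>m N"
    using det_non_zero_imp_unit[OF P] by (auto simp: Units_def ring_mat_def)
  have "M = Q * (P * M)"
    using Q P M by (simp flip: assoc_mult_mat)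
  also have "\<dots> = Q * D * P"
    unfolding PM using Q P D by (simp add: assoc_mult_mat)
  finally have "similar_mat_wit M D Q P"
    using Q P M D by (intro similar_mat_witI) auto
  then have sim: "similar_mat M D" by (auto simp: similar_mat_def)

  \<comment> \<open>The diagonal of \<open>D\<close> lists \<open>ev S\<close> once for each element
    of the kernel basis of the complement of \<open>S\<close>, and the number of these is a
    derangement number.\<close>
  have prod_index: "(\<Prod>k\<leftarrow>[0..<N]. f (fst (h k))) =
      (\<Prod>S\<in>Pow A. f S ^ derangement_number (n - card S))" for f :: "nat set \<Rightarrow> real poly"
  proof -
    have "(\<Prod>k\<leftarrow>[0..<N]. f (fst (h k))) = (\<Prod>k\<in>{0..<N}. f (fst (h k)))"
      by (simp add: flip: prod.distinct_set_conv_list)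
    also have "\<dots> = (\<Prod>p\<in>eigen_index q A. f (fst p))"
      by (rule prod.reindex_bij_betw[OF h])
    also have "\<dots> = (\<Prod>S\<in>Pow A. \<Prod>g\<in>kernel_basis q (A - S). f S)"
      unfolding eigen_index_def
      by (subst prod.Sigma) (use finA in \<open>auto simp: finite_kernel_basis case_prod_unfold\<close>)
    also have "\<dots> = (\<Prod>S\<in>Pow A. f S ^ derangement_number (n - card S))"
      using finA cardA
      by (intro prod.cong) (auto simp: card_kernel_basis[OF _ assms(2)] card_Diff_subset finite_subset)
    finally show ?thesis .
  qed
  have char: "char_poly M = (\<Prod>S\<in>Pow A. [:- ev S, 1:] ^ derangement_number (n - card S))"
  proof -
    have "char_poly M = char_poly D" by (rule char_poly_similar[OF sim])
    also have "\<dots> = (\<Prod>c\<leftarrow>diag_mat D. [:- c, 1:])"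
      by (rule char_poly_upper_triangular[OF D]) (auto simp: D_def)
    also have "\<dots> = (\<Prod>k\<leftarrow>[0..<N]. [:- ev (fst (h k)), 1:])"
      unfolding diag_mat_def by (rule arg_cong[where f = prod_list]) (auto simp: D_def)
    also have "\<dots> = (\<Prod>S\<in>Pow A. [:- ev S, 1:] ^ derangement_number (n - card S))"
      by (rule prod_index)
    finally show ?thesis .
  qed
  \<comment> \<open>A factor with exponent 0 contributes no root, hence the condition on the
    derangement number; such factors come from sets of size \<open>n - 1\<close>.\<close>
  have eigen: "{c. eigenvalue M c} = {ev S | S. S \<subseteq> A \<and> derangement_number (n - card S) \<noteq> 0}"
    using finA by (auto simp: eigenvalue_root_char_poly[OF M] char poly_prod)
  \<comment> \<open>Different sets may share an eigenvalue, so the exponents of all factors with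
    root \<open>c\<close> are added.\<close>
  have ord: "order c (char_poly M) = (\<Sum>S | S \<subseteq> A \<and> ev S = c. derangement_number (n - card S))" for c
  proof -
    have "order c ([:- ev S, 1:] ^ m) = (if ev S = c then m else 0)" for S m
    proof (cases "ev S = c")
      case True
      then show ?thesis by (simp add: order_power_n_n)
    next
      case False
      then show ?thesis by (simp add: order_0I)
    qed
    then have "order c (char_poly M) =
        (\<Sum>S\<in>Pow A. if ev S = c then derangement_number (n - card S) else 0)"
      unfolding char by (subst order_prod) auto
    also have "\<dots> = (\<Sum>S\<in>{S \<in> Pow A. ev S = c}. derangement_number (n - card S))"
      by (rule sum.inter_filter[symmetric]) (use finA in simp)
    finally show ?thesis by simp
  qed
  have "diagonalizable_mat M"
    unfolding diagonalizable_mat_def using sim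
    by (intro exI[of _ D]) (auto simp: D_def diagonal_mat_def)
  then show ?thesis
    using char eigen ord unfolding M_def A_def ev_def by blast
qed

end
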